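(* The following hold for primitive Burnside groups $PF_2(d)$ and free Burnside groups $F_2(d)$ of rank $2$: (1) $PF_2(2)\cong F_2(2)$, a group of order $4$; (2) $PF_2(3)\cong F_2(3)$, a group of order $27$; (3) $PF_2(4)$ and $PF_2(5)$ are both infinite groups.
   Context: The free Burnside group of rank $n$ and exponent $d$ is $$F_n(d)=\langle x_1,\dots,x_n\mid w(x_1,\dots,x_n)^d=1\text{ for all words } w\rangle.$$ An element (word) of a free group is primitive if it is a member of some basis (free generating set) of the free group. The primitive Burnside group of rank $n$ and exponent $d$ is $$PF_n(d)=\langle x_1,\dots,x_n\mid w(x_1,\dots,x_n)^d=1 \text{ for all primitive words } w \text{ in the free group on } x_1,\dots,x_n\rangle.$$ *)

theory Defs
  imports "HOL-Algebra.Coset"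
begin

section \<open>Free groups\<close>

text \<open>The letter \<open>(x, True)\<close> stands for the generator \<open>x\<close>, the letter \<open>(x, False)\<close> for its
  formal inverse. Elements of the free group are represented by their reduced words, so equality
  in the free group is equality of lists.\<close>

definition inv_letter :: "'a \<times> bool \<Rightarrow> 'a \<times> bool" where
  "inv_letter a = (fst a, \<not> snd a)"

definition reduced :: "('a \<times> bool) list \<Rightarrow> bool" where
  "reduced = successively (\<lambda>a b. b \<noteq> inv_letter a)"

fun push_letter :: "'a \<times> bool \<Rightarrow> ('a \<times> bool) list \<Rightarrow> ('a \<times> bool) list" where
  "push_letter a [] = [a]"
| "push_letter a (b # w) = (if b = inv_letter a then w else a # b # w)"

text \<open>For reduced words \<open>u\<close> and \<open>v\<close>, \<open>foldr push_letter u v\<close> is the reduced form of the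
  concatenation \<open>u @ v\<close>.\<close>

definition free_group :: "'a set \<Rightarrow> ('a \<times> bool) list monoid" where
  "free_group X =
     \<lparr>carrier = {w \<in> lists (X \<times> UNIV). reduced w}, mult = foldr push_letter, one = []\<rparr>"

lemma inv_letter_inv_letter [simp]: "inv_letter (inv_letter a) = a"
  by (simp add: inv_letter_def)

lemma push_letter_reduced: "reduced w \<Longrightarrow> reduced (push_letter a w)"
  by (cases w) (auto simp: reduced_def successively_Cons)

lemma push_letter_inv_letter: "reduced w \<Longrightarrow> push_letter a (push_letter (inv_letter a) w) = w"
  by (cases w rule: remdups_adj.cases) (auto simp: reduced_def)

lemma foldr_push_letter_reduced: "reduced w \<Longrightarrow> reduced (foldr push_letter u w)"
  by (induction u) (auto intro: push_letter_reduced)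

lemma foldr_push_letter_push_letter:
  "reduced w \<Longrightarrow>
     foldr push_letter (push_letter a v) w = push_letter a (foldr push_letter v w)"
  by (cases v) (auto simp: push_letter_inv_letter foldr_push_letter_reduced)

lemma foldr_push_letter_assoc:
  "reduced w \<Longrightarrow>
     foldr push_letter (foldr push_letter u v) w = foldr push_letter u (foldr push_letter v w)"
  by (induction u) (auto simp: foldr_push_letter_push_letter)

lemma push_letter_in_lists:
  "fst a \<in> X \<Longrightarrow> w \<in> lists (X \<times> UNIV) \<Longrightarrow> push_letter a w \<in> lists (X \<times> UNIV)"
  by (cases w; cases a) auto

lemma foldr_push_letter_in_lists:
  "u \<in> lists (X \<times> UNIV) \<Longrightarrow> w \<in> lists (X \<times> UNIV) \<Longrightarrow>
     foldr push_letter u w \<in> lists (X \<times> UNIV)"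
proof (induction u)
  case (Cons a u)
  then have "foldr push_letter u w \<in> lists (X \<times> UNIV)" and "fst a \<in> X" by auto
  then show ?case by (simp only: foldr.simps o_apply push_letter_in_lists)
qed simp

lemma foldr_push_letter_rev_inv:
  "reduced w \<Longrightarrow> foldr push_letter (map inv_letter (rev u)) (foldr push_letter u w) = w"
proof (induction u)
  case (Cons a u)
  then show ?case
    using push_letter_inv_letter[of "foldr push_letter u w" "inv_letter a"]
    by (simp add: foldr_push_letter_reduced)
qed auto

lemma foldr_push_letter_Nil: "reduced w \<Longrightarrow> foldr push_letter w [] = w"
proof (induction w)
  case (Cons a w)
  then have "reduced w" by (auto simp: reduced_def successively_Cons)
  with Cons show ?case by (cases w) (auto simp: reduced_def)
qed auto

lemma reduced_rev_inv: "reduced w \<Longrightarrow> reduced (map inv_letter (rev w))"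
proof -
  assume "reduced w"
  then show ?thesis
    unfolding reduced_def successively_map rev_map successively_rev
    by (rule successively_mono) (metis inv_letter_inv_letter)
qed

theorem group_free_group: "group (free_group X)"
proof (rule groupI)
  fix u assume u: "u \<in> carrier (free_group X)"
  have "map inv_letter (rev u) \<in> carrier (free_group X)"
    using u by (fastforce simp: free_group_def reduced_rev_inv inv_letter_def)
  moreover have "map inv_letter (rev u) \<otimes>\<^bsub>free_group X\<^esub> u = \<one>\<^bsub>free_group X\<^esub>"
    using u foldr_push_letter_rev_inv[of "[]" u] foldr_push_letter_Nil[of u]
    by (simp add: free_group_def reduced_def)
  ultimately show "\<exists>v \<in> carrier (free_group X). v \<otimes>\<^bsub>free_group X\<^esub> u = \<one>\<^bsub>free_group X\<^esub>"
    by blast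
next
  fix u v assume "u \<in> carrier (free_group X)" "v \<in> carrier (free_group X)"
  then show "u \<otimes>\<^bsub>free_group X\<^esub> v \<in> carrier (free_group X)"
    using foldr_push_letter_in_lists[of u X v] by (simp add: free_group_def foldr_push_letter_reduced)
next
  show "\<one>\<^bsub>free_group X\<^esub> \<in> carrier (free_group X)"
    by (simp add: free_group_def reduced_def)
next
  fix u v w
  assume "w \<in> carrier (free_group X)"
  then show "u \<otimes>\<^bsub>free_group X\<^esub> v \<otimes>\<^bsub>free_group X\<^esub> w =
        u \<otimes>\<^bsub>free_group X\<^esub> (v \<otimes>\<^bsub>free_group X\<^esub> w)"
    by (simp add: free_group_def foldr_push_letter_assoc)
qed (simp add: free_group_def)

section \<open>Bases and primitive elements\<close>

definition eval_word :: "('a, 'b) monoid_scheme \<Rightarrow> ('a \<times> bool) list \<Rightarrow> 'a" where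
  "eval_word G w =
     foldr (\<lambda>(x, e) y. (if e then x else inv\<^bsub>G\<^esub> x) \<otimes>\<^bsub>G\<^esub> y) w \<one>\<^bsub>G\<^esub>"

text \<open>\<open>B\<close> is a free generating set of \<open>G\<close> if the canonical map from the free group on \<open>B\<close>
  to \<open>G\<close> (the one that restricts to the inclusion on \<open>B\<close>) is an isomorphism.\<close>

definition is_basis :: "('a, 'b) monoid_scheme \<Rightarrow> 'a set \<Rightarrow> bool" where
  "is_basis G B \<longleftrightarrow> B \<subseteq> carrier G \<and> eval_word G \<in> iso (free_group B) G"

definition primitive :: "('a, 'b) monoid_scheme \<Rightarrow> 'a \<Rightarrow> bool" where
  "primitive G w \<longleftrightarrow> (\<exists>B. is_basis G B \<and> w \<in> B)"

section \<open>Group presentations\<close>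

definition normal_closure :: "('a, 'b) monoid_scheme \<Rightarrow> 'a set \<Rightarrow> 'a set" where
  "normal_closure G R = \<Inter> {N. N \<lhd> G \<and> R \<subseteq> N}"

definition presented_group ::
    "'a set \<Rightarrow> ('a \<times> bool) list set \<Rightarrow> ('a \<times> bool) list set monoid" where
  "presented_group X R = free_group X Mod normal_closure (free_group X) R"

lemma (in group) carrier_normal: "carrier G \<lhd> G"
  by (simp add: normal_inv_iff subgroup_self)

lemma (in group) normal_normal_closure:
  assumes "R \<subseteq> carrier G"
  shows "normal_closure G R \<lhd> G"
proof -
  have "subgroup (normal_closure G R) G"
    unfolding normal_closure_def
    by (rule subgroups_Inter) (use assms carrier_normal normal_imp_subgroup in auto)
  then show ?thesis
    by (auto simp: normal_inv_iff normal_closure_def)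
qed

theorem group_presented_group:
  assumes "R \<subseteq> carrier (free_group X)"
  shows "group (presented_group X R)"
  unfolding presented_group_def
  by (intro normal.factorgroup_is_group group.normal_normal_closure group_free_group assms)

section \<open>Burnside groups\<close>

definition free_burnside_group :: "nat \<Rightarrow> nat \<Rightarrow> (nat \<times> bool) list set monoid" where
  "free_burnside_group n d =
     presented_group {1..n}
       {w [^]\<^bsub>free_group {1..n}\<^esub> d |w. w \<in> carrier (free_group {1..n})}"

definition primitive_burnside_group :: "nat \<Rightarrow> nat \<Rightarrow> (nat \<times> bool) list set monoid" where
  "primitive_burnside_group n d =
     presented_group {1..n}
       {w [^]\<^bsub>free_group {1..n}\<^esub> d |w. primitive (free_group {1..n}) w}"

lemma group_free_burnside_group: "group (free_burnside_group n d)"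
  unfolding free_burnside_group_def
  by (rule group_presented_group)
     (auto intro: monoid.nat_pow_closed group.is_monoid group_free_group)

lemma group_primitive_burnside_group: "group (primitive_burnside_group n d)"
  unfolding primitive_burnside_group_def
  by (rule group_presented_group)
     (auto intro!: monoid.nat_pow_closed group.is_monoid group_free_group
       simp: primitive_def is_basis_def)

end

theory Submission
  imports Defs Complex_Main "HOL-Algebra.Multiplicative_Group"
begin

text \<open>For \<open>d = 2, 3\<close> the \<open>d\<close>-th powers of the primitive words \<open>x, y, x y, x y\<^sup>-\<^sup>1\<close> already force the group
  to be a quotient of a finite Heisenberg group of exponent \<open>d\<close>; hence both normal closures are
  the kernel of the map onto that group.

  For \<open>d \<ge> 4\<close> consider the free group of rank two as the kernel of the map from the braid group on
  four strands to the one on three strands. The reduced Burau representation, specialised so that the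
  standard generators become complex reflections of order \<open>d\<close>, maps the free generator
  \<open>\<sigma>\<^sub>1 \<sigma>\<^sub>3\<^sup>-\<^sup>1\<close> to an element of order \<open>d\<close>. By Nielsen's theorem all primitive words are
  conjugate to it under braids and an antilinear reflection, so their \<open>d\<close>-th powers act
  trivially. The image is infinite: it contains an element that acts on an invariant plane with
  determinant \<open>1\<close> and real trace at least \<open>2\<close>, but not trivially.\<close>

section \<open>Homomorphisms from free groups\<close>

text \<open>Why a reflection is needed: the braid group acts on the free kernel by conjugation, so
  each automorphism induced by a braid is realised by an intertwiner of the Burau representation. On
  the abelianisation these automorphisms have determinant 1, whereas inverting one generator or
  swapping the two has determinant -1. Complex conjugation, which exchanges a parameter on the unit
  circle with its inverse, supplies the missing sign. Since one intertwiner is antilinear, the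
  representation takes values in the self-maps of a set, and only the surjectivity of intertwiners
  is kept.

  Where the bound on \<open>d\<close> comes from: with \<open>c = 2 * cos (2 * pi / d)\<close> the
  trace on the invariant plane is \<open>2 + c * (4 - c^2)\<close>, which is at least 2 for
  \<open>c\<close> between 0 and 2. At \<open>d = 3\<close> one has \<open>c = -1\<close> and trace
  -1, in accordance with the finite group. At \<open>d = 4\<close> the trace is exactly 2, so that
  eigenvalues cannot detect infinite order; a growing sequence of norms does it for all
  \<open>d\<close> at once.\<close>

definition word_hom :: "('b, 'm) monoid_scheme \<Rightarrow> ('a \<times> bool \<Rightarrow> 'b) \<Rightarrow> ('a \<times> bool) list \<Rightarrow> 'b" where
  "word_hom M f w = foldr (\<lambda>a y. f a \<otimes>\<^bsub>M\<^esub> y) w \<one>\<^bsub>M\<^esub>"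

definition inv_word :: "('a \<times> bool) list \<Rightarrow> ('a \<times> bool) list" where
  "inv_word w = map inv_letter (rev w)"

lemma word_hom_Nil [simp]: "word_hom M f [] = \<one>\<^bsub>M\<^esub>"
  by (simp add: word_hom_def)

lemma word_hom_Cons [simp]: "word_hom M f (a # w) = f a \<otimes>\<^bsub>M\<^esub> word_hom M f w"
  by (simp add: word_hom_def)

lemma eval_word_eq_word_hom:
  "eval_word G = word_hom G (\<lambda>(x, e). if e then x else inv\<^bsub>G\<^esub> x)"
  by (simp add: fun_eq_iff eval_word_def word_hom_def case_prod_unfold)

lemma word_hom_closed:
  assumes "monoid M" and "\<And>a. a \<in> X \<times> UNIV \<Longrightarrow> f a \<in> carrier M" and "w \<in> lists (X \<times> UNIV)"
  shows "word_hom M f w \<in> carrier M"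
  using assms(3) by (induction w) (use assms(1,2) in \<open>auto intro: monoid.m_closed\<close>)

text \<open>The target is only a monoid, with mutually inverse images of inverse letters. This
  covers evaluation in groups as well as representations by self-maps.\<close>

lemma word_hom_hom:
  assumes M: "monoid M" and f: "\<And>a. a \<in> X \<times> UNIV \<Longrightarrow> f a \<in> carrier M"
    and inv: "\<And>a. a \<in> X \<times> UNIV \<Longrightarrow> f a \<otimes>\<^bsub>M\<^esub> f (inv_letter a) = \<one>\<^bsub>M\<^esub>"
  shows "word_hom M f \<in> hom (free_group X) M"
proof -
  interpret monoid M by (rule M)
  have closed: "word_hom M f w \<in> carrier M" if "w \<in> lists (X \<times> UNIV)" for w
    using M f that by (rule word_hom_closed)
  have push: "word_hom M f (push_letter a w) = f a \<otimes>\<^bsub>M\<^esub> word_hom M f w"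
    if a: "a \<in> X \<times> UNIV" and w: "w \<in> lists (X \<times> UNIV)" for a w
  proof (cases "\<exists>w'. w = inv_letter a # w'")
    case True
    then obtain w' where w': "w = inv_letter a # w'" by blast
    have "inv_letter a \<in> X \<times> UNIV" "w' \<in> lists (X \<times> UNIV)" using w w' by auto
    then have "f a \<otimes>\<^bsub>M\<^esub> word_hom M f w = (f a \<otimes>\<^bsub>M\<^esub> f (inv_letter a)) \<otimes>\<^bsub>M\<^esub> word_hom M f w'"
      using f[OF a] f closed by (simp add: w' m_assoc)
    then show ?thesis
      using inv[OF a] \<open>w' \<in> _\<close> closed by (simp add: w')
  next
    case False
    then show ?thesis by (cases w) auto
  qed
  have "word_hom M f (foldr push_letter u v) = word_hom M f u \<otimes>\<^bsub>M\<^esub> word_hom M f v"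
    if u: "u \<in> lists (X \<times> UNIV)" and v: "v \<in> lists (X \<times> UNIV)" for u v
    using u
  proof (induction u)
    case Nil
    then show ?case using closed[OF v] by simp
  next
    case (Cons a u)
    then show ?case
      using closed[OF v] closed[of u] f[of a] foldr_push_letter_in_lists[OF _ v, of u]
      by (simp add: push m_assoc)
  qed
  then show ?thesis
    using closed by (auto simp: hom_def free_group_def)
qed

section \<open>Formal inverses of words\<close>

lemma inv_word_inv_word [simp]: "inv_word (inv_word w) = w"
  by (simp add: inv_word_def rev_map comp_def)

lemma length_inv_word [simp]: "length (inv_word w) = length w"
  by (simp add: inv_word_def)

lemma inv_word_Nil [simp]: "inv_word [] = []"
  by (simp add: inv_word_def)

lemma inv_word_eq_Nil [simp]: "inv_word w = [] \<longleftrightarrow> w = []"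
  by (simp add: inv_word_def)

lemma inv_word_append: "inv_word (u @ v) = inv_word v @ inv_word u"
  by (simp add: inv_word_def)

lemma inv_word_Cons: "inv_word (a # v) = inv_word v @ [inv_letter a]"
  by (simp add: inv_word_def)

lemma reduced_inv_word: "reduced w \<Longrightarrow> reduced (inv_word w)"
  unfolding inv_word_def by (rule reduced_rev_inv)

lemma carrier_free_group_iff:
  "w \<in> carrier (free_group X) \<longleftrightarrow> w \<in> lists (X \<times> UNIV) \<and> reduced w"
  by (simp add: free_group_def)

lemma mult_free_group: "u \<otimes>\<^bsub>free_group X\<^esub> v = foldr push_letter u v"
  by (simp add: free_group_def)

lemma one_free_group: "\<one>\<^bsub>free_group X\<^esub> = []"
  by (simp add: free_group_def)

lemma inv_word_closed: "w \<in> carrier (free_group X) \<Longrightarrow> inv_word w \<in> carrier (free_group X)"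
  by (fastforce simp: carrier_free_group_iff reduced_inv_word inv_word_def inv_letter_def
      intro: reduced_rev_inv)

lemma inv_free_group:
  assumes "w \<in> carrier (free_group X)"
  shows "inv\<^bsub>free_group X\<^esub> w = inv_word w"
proof -
  interpret group "free_group X" by (rule group_free_group)
  have "inv_word w \<otimes>\<^bsub>free_group X\<^esub> w = \<one>\<^bsub>free_group X\<^esub>"
    using assms foldr_push_letter_rev_inv[of "[]" w] foldr_push_letter_Nil[of w]
    by (simp add: carrier_free_group_iff mult_free_group one_free_group inv_word_def reduced_def)
  with assms show ?thesis by (intro inv_equality inv_word_closed)
qed

lemma letter_closed: "x \<in> X \<Longrightarrow> [(x, e)] \<in> carrier (free_group X)"
  by (simp add: carrier_free_group_iff reduced_def)

lemma inv_letter_free_group: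
  "x \<in> X \<Longrightarrow> inv\<^bsub>free_group X\<^esub> [(x, e)] = [(x, \<not> e)]"
  by (simp add: inv_free_group letter_closed inv_word_def inv_letter_def)

lemma reduced_ConsD: "reduced (a # w) \<Longrightarrow> reduced w"
  by (auto simp: reduced_def successively_Cons)

lemma Cons_free_group:
  assumes "reduced (a # w)"
  shows "a # w = [a] \<otimes>\<^bsub>free_group X\<^esub> w"
  using assms by (cases w) (auto simp: mult_free_group reduced_def)

lemma hom_free_group_eqI:
  assumes G: "group G" and h: "h \<in> hom (free_group X) G" and h': "h' \<in> hom (free_group X) G"
    and eq: "\<And>x. x \<in> X \<Longrightarrow> h [(x, True)] = h' [(x, True)]"
    and w: "w \<in> carrier (free_group X)"
  shows "h w = h' w"
proof -
  interpret h: group_hom "free_group X" G h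
    by (simp add: group_hom_def group_hom_axioms_def G h group_free_group)
  interpret h': group_hom "free_group X" G h'
    by (simp add: group_hom_def group_hom_axioms_def G h' group_free_group)
  have letter: "h [(x, e)] = h' [(x, e)]" if "x \<in> X" for x e
  proof (cases e)
    case False
    have "h (inv\<^bsub>free_group X\<^esub> [(x, True)]) = h' (inv\<^bsub>free_group X\<^esub> [(x, True)])"
      using that by (simp add: eq letter_closed)
    then show ?thesis using False that by (simp add: inv_letter_free_group)
  qed (simp add: eq that)
  show ?thesis
    using w
  proof (induction w)
    case Nil
    then show ?case using h.hom_one h'.hom_one by (simp add: one_free_group)
  next
    case (Cons a w)
    then have red: "reduced (a # w)" and a: "fst a \<in> X"
      and w: "w \<in> carrier (free_group X)" and la: "[a] \<in> carrier (free_group X)"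
      by (auto simp: carrier_free_group_iff dest: reduced_ConsD) (auto simp: reduced_def)
    from Cons.IH[OF w] letter[OF a, of "snd a"] show ?case
      unfolding Cons_free_group[OF red, of X] using la w by simp
  qed
qed

lemma eval_word_hom:
  assumes "group G" "B \<subseteq> carrier G"
  shows "eval_word G \<in> hom (free_group B) G"
proof -
  interpret group G by fact
  show ?thesis
    unfolding eval_word_eq_word_hom
    by (rule word_hom_hom) (use assms(2) in \<open>auto simp: inv_letter_def monoid_axioms\<close>)
qed

section \<open>Nielsen reduction of generating pairs\<close>

fun lcp :: "'a list \<Rightarrow> 'a list \<Rightarrow> nat" where
  "lcp (x # xs) (y # ys) = (if x = y then Suc (lcp xs ys) else 0)"
| "lcp _ _ = 0"

lemma lcp_commute: "lcp u v = lcp v u"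
  by (induction u v rule: lcp.induct) auto

lemma lcp_le: "lcp u v \<le> length u" "lcp u v \<le> length v"
  by (induction u v rule: lcp.induct) auto

lemma lcp_self [simp]: "lcp u u = length u"
  by (induction u) auto

text \<open>\<open>v\<close> and \<open>w\<close> still agree where \<open>u\<close> branches off
  from \<open>v\<close>, so \<open>u\<close> branches off from \<open>w\<close> at the same place.
  This transfers the cancellation against one factor to a whole product.\<close>

lemma lcp_ultrametric: "lcp u v < lcp v w \<Longrightarrow> lcp u w = lcp u v"
proof (induction u v arbitrary: w rule: lcp.induct)
  case (1 x xs y ys)
  show ?case
  proof (cases w)
    case (Cons z zs)
    show ?thesis
    proof (cases "x = y \<and> y = z")
      case True
      with 1 Cons have "lcp xs zs = lcp xs ys" by simp
      with True Cons show ?thesis by simp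
    qed (use 1(2) Cons in \<open>auto split: if_splits\<close>)
  qed (use 1(2) in simp)
qed auto

lemma take_lcp: "k \<le> lcp u v \<Longrightarrow> take k u = take k v"
proof (induction u v arbitrary: k rule: lcp.induct)
  case (1 x xs y ys)
  then show ?case by (cases k) (auto split: if_splits)
qed auto

lemma lcp_append_ge: "length p \<le> lcp (p @ u) (p @ v)"
  by (induction p) auto

lemma lcp_pos_iff: "0 < lcp u v \<longleftrightarrow> u \<noteq> [] \<and> v \<noteq> [] \<and> hd u = hd v"
  by (cases u; cases v) auto

lemma reduced_append_iff:
  "reduced (u @ v) \<longleftrightarrow>
     reduced u \<and> reduced v \<and> (u \<noteq> [] \<longrightarrow> v \<noteq> [] \<longrightarrow> hd v \<noteq> inv_letter (last u))"
  by (auto simp: reduced_def successively_append_iff)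

lemma foldr_push_letter_append: "reduced (u @ v) \<Longrightarrow> foldr push_letter u v = u @ v"
proof (induction u)
  case (Cons a u)
  then have "foldr push_letter u v = u @ v" by (auto dest: reduced_ConsD)
  with Cons.prems show ?case by (cases "u @ v") (auto simp: reduced_def)
qed auto

text \<open>What cancels in the quotient is exactly the common prefix, so \<open>lcp u v\<close>
  counts the cancelled pairs of letters.\<close>

lemma inv_word_mult:
  assumes "reduced u" "reduced v"
  shows "foldr push_letter (inv_word u) v =
    inv_word (drop (lcp u v) u) @ drop (lcp u v) v"
  using assms
proof (induction u v rule: lcp.induct)
  case (1 x xs y ys)
  show ?case
  proof (cases "x = y")
    case True
    with 1 show ?thesis by (auto simp: inv_word_Cons dest: reduced_ConsD)
  next
    case False
    have "reduced (inv_word (x # xs) @ y # ys)"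
      using 1(2,3) False reduced_inv_word[OF 1(2)]
      by (subst reduced_append_iff) (auto simp: inv_word_Cons)
    then show ?thesis
      using False by (simp add: foldr_push_letter_append)
  qed
next
  case ("2_1" v)
  then show ?case by simp
next
  case ("2_2" u)
  then show ?case
    using foldr_push_letter_Nil[OF reduced_inv_word] by (cases u) auto
qed

lemma length_inv_word_mult:
  assumes "reduced u" "reduced v"
  shows "length (foldr push_letter (inv_word u) v) + 2 * lcp u v = length u + length v"
  using assms lcp_le[of u v] by (simp add: inv_word_mult)

lemma lcp_inv_word_mult:
  assumes "reduced u" "reduced v"
  shows "length u \<le> lcp (foldr push_letter (inv_word u) v) (inv_word u) + lcp u v"
proof -
  let ?k = "lcp u v"
  have "inv_word u = inv_word (drop ?k u) @ inv_word (take ?k u)"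
    by (metis append_take_drop_id inv_word_append)
  then have "length (inv_word (drop ?k u)) \<le> lcp (foldr push_letter (inv_word u) v) (inv_word u)"
    using lcp_append_ge by (metis inv_word_mult[OF assms])
  then show ?thesis by simp
qed

lemma nth_inv_word: "i < length w \<Longrightarrow> inv_word w ! i = inv_letter (w ! (length w - Suc i))"
  by (simp add: inv_word_def rev_nth)

lemma inv_letter_neq [simp]: "inv_letter a \<noteq> a" "a \<noteq> inv_letter a"
  by (cases a, simp add: inv_letter_def)+

text \<open>If \<open>u\<close> and its inverse agreed on half of \<open>u\<close>, the middle of
  \<open>u\<close> would be a letter equal to its own inverse (odd length) or an adjacent cancelling
  pair (even length).\<close>

lemma lcp_inv_word:
  assumes "reduced u" "u \<noteq> []"
  shows "2 * lcp u (inv_word u) < length u"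
proof (rule ccontr)
  let ?i = "(length u - 1) div 2" and ?j = "length u - Suc ((length u - 1) div 2)"
  assume neg: "\<not> ?thesis"
  have n: "length u > 0" using assms(2) by simp
  with neg have i: "?i < lcp u (inv_word u)" "?i < length u" by linarith+
  have "take (lcp u (inv_word u)) u ! ?i = take (lcp u (inv_word u)) (inv_word u) ! ?i"
    using take_lcp[OF order_refl, of u "inv_word u"] by (rule arg_cong)
  with i have eq: "u ! ?i = inv_letter (u ! ?j)"
    by (simp add: nth_inv_word)
  show False
  proof (cases "even (length u)")
    case True
    then obtain m where "length u = 2 * m" by blast
    then have j: "?j = Suc ?i" "Suc ?i < length u" using n by (cases m; simp)+
    then have "u ! ?j \<noteq> inv_letter (u ! ?i)"
      using assms(1) by (simp add: reduced_def successively_conv_nth)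
    with eq show False by simp
  next
    case False
    then obtain m where "length u = 2 * m + 1" by (auto elim: oddE)
    then have "?j = ?i" by simp
    with eq show False by simp
  qed
qed

text \<open>The index is the first factor of a product in which no factor is followed by its
  inverse. A new factor enters as \<open>inv_word t\<close>, so that its cancellation against the
  old first factor \<open>s\<close> is \<open>lcp t s\<close>.\<close>

inductive nielsen_word :: "('a \<times> bool) list set \<Rightarrow> ('a \<times> bool) list \<Rightarrow> ('a \<times> bool) list \<Rightarrow> bool"
  for S where
  base: "s \<in> S \<Longrightarrow> nielsen_word S s s"
| step: "nielsen_word S s w \<Longrightarrow> t \<in> S \<Longrightarrow> t \<noteq> s \<Longrightarrow>
    nielsen_word S (inv_word t) (foldr push_letter (inv_word t) w)"

lemma nielsen_word_reduced:
  "nielsen_word S s w \<Longrightarrow> (\<And>s. s \<in> S \<Longrightarrow> reduced s) \<Longrightarrow> reduced w"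
  by (induction rule: nielsen_word.induct) (auto intro: foldr_push_letter_reduced)

lemma generate_nielsen_word:
  assumes S: "S \<subseteq> carrier (free_group X)" and inv: "\<And>s. s \<in> S \<Longrightarrow> inv_word s \<in> S"
    and w: "w \<in> generate (free_group X) S"
  shows "w = [] \<or> (\<exists>s. nielsen_word S s w)"
proof -
  have red: "reduced s" if "s \<in> S" for s
    using S that by (auto simp: carrier_free_group_iff)
  define K where "K = insert [] {w. \<exists>s. nielsen_word S s w}"
  have K_red: "reduced k" if "k \<in> K" for k
    using that nielsen_word_reduced[of S _ k] red by (auto simp: K_def reduced_def)
  have letter: "foldr push_letter r k \<in> K" if r: "r \<in> S" and k: "k \<in> K" for r k
  proof (cases "k = []")
    case True
    with r show ?thesis
      by (auto simp: K_def foldr_push_letter_Nil red intro: base)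
  next
    case False
    with k obtain s where s: "nielsen_word S s k" by (auto simp: K_def)
    show ?thesis
    proof (cases "s = inv_word r")
      case False
      with step[OF s inv[OF r]] show ?thesis by (auto simp: K_def)
    next
      \<comment> \<open>The new factor cancels the first one and uncovers the product from which the
        word was built, which is again admissible.\<close>
      case True
      from s show ?thesis
      proof cases
        case base
        then show ?thesis
          using True foldr_push_letter_rev_inv[of "[]" "inv_word r"] foldr_push_letter_Nil[of "inv_word r"]
            red[OF inv[OF r]]
          by (simp add: K_def reduced_def flip: inv_word_def)
      next
        case (step s' w t)
        then have "t = r" using True by (metis inv_word_inv_word)
        moreover have "reduced w" using step nielsen_word_reduced red by metis
        ultimately have "foldr push_letter r k = w"
          using step foldr_push_letter_rev_inv[of w "inv_word r"]
          by (simp flip: inv_word_def)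
        then show ?thesis using step by (auto simp: K_def)
      qed
    qed
  qed
  \<comment> \<open>Invariance of \<open>K\<close> under left multiplication passes to products,
    unlike membership in \<open>K\<close>; applied to the empty word it gives membership.\<close>
  have "\<forall>k\<in>K. foldr push_letter w k \<in> K"
    using w
  proof induction
    case one
    then show ?case by (simp add: one_free_group)
  next
    case (incl h)
    then show ?case by (simp add: letter)
  next
    case (inv h)
    then show ?case using S assms(2) by (auto simp: inv_free_group subset_iff letter)
  next
    case (eng h1 h2)
    then show ?case
      by (simp add: mult_free_group foldr_push_letter_assoc K_red)
  qed
  moreover have "[] \<in> K" by (simp add: K_def)
  moreover have "reduced w"
    using w S group.generate_in_carrier[OF group_free_group, of S X w]
    by (auto simp: carrier_free_group_iff)
  ultimately have "w \<in> K"
    using foldr_push_letter_Nil by metis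
  then show ?thesis by (auto simp: K_def)
qed

text \<open>The second assumption says that at most half of an element of \<open>S\<close> cancels against a neighbour
  in a reduced product, the third one that no element is cancelled completely from both sides.\<close>

lemma nielsen_word_length_one:
  assumes S: "\<And>s. s \<in> S \<Longrightarrow> reduced s \<and> s \<noteq> [] \<and> inv_word s \<in> S"
    and half: "\<And>s t. s \<in> S \<Longrightarrow> t \<in> S \<Longrightarrow> s \<noteq> t \<Longrightarrow> 2 * lcp s t \<le> length s"
    and both: "\<And>s t t'. s \<in> S \<Longrightarrow> t \<in> S \<Longrightarrow> t' \<in> S \<Longrightarrow> s \<noteq> t \<Longrightarrow> t' \<noteq> inv_word s \<Longrightarrow>
      lcp s t + lcp (inv_word s) t' < length s"
    and w: "nielsen_word S s w" and len: "length w = 1"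
  shows "w \<in> S"
proof -
  \<comment> \<open>Invariant: \<open>w\<close> still begins with its first factor \<open>s\<close>,
    apart from an end of length at most \<open>lcp (inv_word s) t'\<close> lost to the next factor
    \<open>t'\<close>. For a single factor any \<open>t'\<close> other than
    \<open>inv_word s\<close> will do.\<close>
  have "s \<in> S \<and> reduced w \<and> (\<exists>t'\<in>S. t' \<noteq> inv_word s \<and> length s \<le> lcp w s + lcp (inv_word s) t')
      \<and> (w = s \<or> 2 \<le> length w)"
    using w
  proof induction
    case (base s)
    have "s \<noteq> inv_word s"
      using lcp_inv_word[of s] S[OF base] by auto
    then show ?case using base S[OF base] by auto
  next
    case (step s w t)
    then obtain t' where t': "t' \<in> S" "t' \<noteq> inv_word s" "length s \<le> lcp w s + lcp (inv_word s) t'"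
      and s: "s \<in> S" "reduced w" "w = s \<or> 2 \<le> length w" by auto
    have "lcp s t + lcp (inv_word s) t' < length s"
      using both s(1) step(2) t'(1,2) step(3) by blast
    then have "lcp t s < lcp s w" using t'(3) by (simp add: lcp_commute)
    \<comment> \<open>The new factor stops cancelling inside the surviving part of \<open>s\<close>,
      hence cancels against \<open>w\<close> exactly as against \<open>s\<close> alone.\<close>
    then have eq: "lcp t w = lcp t s" by (rule lcp_ultrametric)
    have t: "reduced t" "t \<noteq> []" using S[OF step(2)] by auto
    let ?w = "foldr push_letter (inv_word t) w"
    have len: "length ?w + 2 * lcp t s = length t + length w"
      using length_inv_word_mult[OF t(1) s(2)] eq by simp
    have "2 \<le> length ?w"
    proof (cases "2 \<le> length w")
      case True
      with len half[OF step(2) s(1) step(3)] show ?thesis by linarith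
    next
      case False
      then have w: "w = s" using s by auto
      moreover have "s \<noteq> []" using S s by auto
      ultimately have "length s = 1" using False by (simp add: not_le less_Suc_eq_le Suc_leI le_antisym)
      moreover have "lcp s t < length s" using \<open>lcp s t + _ < length s\<close> by simp
      ultimately have "lcp t s = 0" by (simp add: lcp_commute)
      with len w \<open>length s = 1\<close> t show ?thesis by (cases t) auto
    qed
    moreover have "length t \<le> lcp ?w (inv_word t) + lcp t s"
      using lcp_inv_word_mult[OF t(1) s(2)] eq by simp
    ultimately show ?case
      using S[OF step(2)] s step(3) by (auto intro!: foldr_push_letter_reduced bexI[of _ s])
  qed
  with len show ?thesis by auto
qed

section \<open>Conjugation and generating pairs\<close>

lemma length_foldr_push_letter: "length (foldr push_letter u v) \<le> length u + length v"
proof (induction u)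
  case (Cons a u)
  have "length (push_letter a w) \<le> Suc (length w)" for w
    by (cases w) auto
  from order_trans[OF this] Cons show ?case by simp
qed simp

lemma hd_inv_word: "w \<noteq> [] \<Longrightarrow> hd (inv_word w) = inv_letter (last w)"
  by (simp add: inv_word_def hd_map hd_rev)

text \<open>Conjugating by the first letter moves it to the end, where it cancels if the word ends
  in its inverse.\<close>

lemma conj_letter:
  assumes "p = e # m"
  shows "length (foldr push_letter (foldr push_letter (inv_word [e]) p) [e]) \<le> length p"
    and "last p = inv_letter e \<Longrightarrow>
      length (foldr push_letter (foldr push_letter (inv_word [e]) p) [e]) < length p"
proof -
  have eq: "foldr push_letter (inv_word [e]) p = m"
    by (simp add: assms inv_word_def)
  then show "length (foldr push_letter (foldr push_letter (inv_word [e]) p) [e]) \<le> length p"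
    using length_foldr_push_letter[of m "[e]"] by (simp add: assms)
  assume last: "last p = inv_letter e"
  then have "m \<noteq> []" "last m = inv_letter e" by (auto simp: assms split: if_splits)
  then obtain m' where "m = m' @ [inv_letter e]" by (metis append_butlast_last_id)
  then have "foldr push_letter m [e] = foldr push_letter m' []" by simp
  then have "length (foldr push_letter m [e]) \<le> length m'"
    using length_foldr_push_letter[of m' "[]"] by simp
  then show "length (foldr push_letter (foldr push_letter (inv_word [e]) p) [e]) < length p"
    unfolding eq using \<open>m = _\<close> by (simp add: assms)
qed

lemma (in group) mult_inv_cancel:
  assumes "x \<in> carrier G" "y \<in> carrier G"
  shows "inv x \<otimes> (x \<otimes> y) = y" "x \<otimes> (inv x \<otimes> y) = y"
  using assms by (simp_all flip: m_assoc)

lemma (in group) generate_eq_carrierI: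
  assumes "generate G A = carrier G" "B \<subseteq> carrier G" "A \<subseteq> generate G B"
  shows "generate G B = carrier G"
proof
  show "carrier G \<subseteq> generate G B"
    using generate_subgroup_incl[OF assms(3) generate_is_subgroup[OF assms(2)]] assms(1) by simp
qed (use generate_incl assms(2) in blast)

lemma (in group) generate_conjugates:
  assumes gen: "generate G {p, q} = carrier G" and p: "p \<in> carrier G" and q: "q \<in> carrier G"
    and g: "g \<in> carrier G"
  shows "generate G {g \<otimes> p \<otimes> inv g, g \<otimes> q \<otimes> inv g} = carrier G" (is "?H = _")
proof
  have sub: "subgroup ?H G"
    using p q g by (intro generate_is_subgroup) auto
  have "g \<otimes> h \<otimes> inv g \<in> ?H" if "h \<in> generate G {p, q}" for h
    using that
  proof induction
    case one
    then show ?case using g by (simp add: generate.one)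
  next
    case (incl h)
    then show ?case by (auto intro: generate.incl)
  next
    case (inv h)
    then have "g \<otimes> h \<otimes> inv g \<in> {g \<otimes> p \<otimes> inv g, g \<otimes> q \<otimes> inv g}" and h: "h \<in> carrier G"
      using p q by blast+
    then have "inv (g \<otimes> h \<otimes> inv g) \<in> ?H" by (intro generate.inv)
    moreover have "inv (g \<otimes> h \<otimes> inv g) = g \<otimes> inv h \<otimes> inv g"
      using g h by (simp add: inv_mult_group m_assoc)
    ultimately show ?case by simp
  next
    case (eng h1 h2)
    then have "h1 \<in> carrier G" "h2 \<in> carrier G" by (simp_all add: gen)
    then have "(g \<otimes> h1 \<otimes> inv g) \<otimes> (g \<otimes> h2 \<otimes> inv g) = g \<otimes> (h1 \<otimes> h2) \<otimes> inv g"
      using g by (simp add: m_assoc mult_inv_cancel)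
    then show ?case using eng subgroup.m_closed[OF sub] by metis
  qed
  then have conj: "g \<otimes> h \<otimes> inv g \<in> ?H" if "h \<in> carrier G" for h
    using that gen by simp
  show "carrier G \<subseteq> ?H"
  proof
    fix w assume w: "w \<in> carrier G"
    then have "g \<otimes> (inv g \<otimes> w \<otimes> g) \<otimes> inv g = w"
      using g by (simp add: m_assoc mult_inv_cancel)
    with conj[of "inv g \<otimes> w \<otimes> g"] w g show "w \<in> ?H" by simp
  qed
qed (use p q g generate_incl[of "{g \<otimes> p \<otimes> inv g, g \<otimes> q \<otimes> inv g}"] in auto)

text \<open>Nielsen's theorem as an induction rule. Ties, where exactly half of the shorter word
  cancels, are usually broken by a well-order on words; simultaneous conjugation as an extra move
  lets induction on the total length suffice.\<close>

theorem nielsen_pair_induct [consumes 4, case_names base inv swap mult conj]: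
  fixes a b :: 'a
  defines "F \<equiv> free_group {a, b}"
  assumes u: "u \<in> carrier F" and v: "v \<in> carrier F" and gen: "generate F {u, v} = carrier F"
    and ab: "a \<noteq> b"
    and base: "P [(a, True)] [(b, True)]"
    and inv: "\<And>p q. p \<in> carrier F \<Longrightarrow> q \<in> carrier F \<Longrightarrow> P p q \<Longrightarrow> P (inv\<^bsub>F\<^esub> p) q"
    and swap: "\<And>p q. p \<in> carrier F \<Longrightarrow> q \<in> carrier F \<Longrightarrow> P p q \<Longrightarrow> P q p"
    and mult: "\<And>p q. p \<in> carrier F \<Longrightarrow> q \<in> carrier F \<Longrightarrow> P p q \<Longrightarrow> P p (p \<otimes>\<^bsub>F\<^esub> q)"
    and conj: "\<And>p q g. p \<in> carrier F \<Longrightarrow> q \<in> carrier F \<Longrightarrow> g \<in> carrier F \<Longrightarrow> P p q \<Longrightarrow>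
      P (g \<otimes>\<^bsub>F\<^esub> p \<otimes>\<^bsub>F\<^esub> inv\<^bsub>F\<^esub> g) (g \<otimes>\<^bsub>F\<^esub> q \<otimes>\<^bsub>F\<^esub> inv\<^bsub>F\<^esub> g)"
  shows "P u v"
proof -
  interpret F: group F unfolding F_def by (rule group_free_group)
  define gp where "gp p q \<longleftrightarrow> p \<in> carrier F \<and> q \<in> carrier F \<and> generate F {p, q} = carrier F" for p q
  have carr: "p \<in> carrier F" "q \<in> carrier F" "reduced p" "reduced q" if "gp p q" for p q
    using that by (auto simp: gp_def F_def carrier_free_group_iff)
  have F_inv [simp]: "inv\<^bsub>F\<^esub> p = inv_word p" if "p \<in> carrier F" for p
    using that by (simp add: F_def inv_free_group)
  have F_mult: "p \<otimes>\<^bsub>F\<^esub> q = foldr push_letter p q" for p q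
    by (simp add: F_def mult_free_group)
  have gpI: "gp p' q'"
    if "gp p q" "p' \<in> carrier F" "q' \<in> carrier F" "p \<in> generate F {p', q'}" "q \<in> generate F {p', q'}"
    for p q p' q'
    using that F.generate_eq_carrierI[of "{p, q}" "{p', q'}"] by (auto simp: gp_def)
  have gp_swap: "gp q p" if "gp p q" for p q
    using that by (simp add: gp_def insert_commute)
  have gp_inv: "gp (inv_word p) q" if "gp p q" for p q
  proof (rule gpI[OF that])
    show ip: "inv_word p \<in> carrier F" using F.inv_closed[of p] carr(1)[OF that] by simp
    have "inv\<^bsub>F\<^esub> (inv_word p) \<in> generate F {inv_word p, q}" by (rule generate.inv) simp
    then show "p \<in> generate F {inv_word p, q}" using ip by simp
  qed (use that carr in \<open>auto intro: generate.incl\<close>)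
  have gp_quot: "gp p (inv_word p \<otimes>\<^bsub>F\<^esub> q)" if "gp p q" for p q
  proof (rule gpI[OF that])
    have c: "p \<in> carrier F" "q \<in> carrier F" "inv_word p \<in> carrier F"
      using carr[OF that] F.inv_closed[of p] by simp_all
    then show "inv_word p \<otimes>\<^bsub>F\<^esub> q \<in> carrier F" by simp
    have "p \<otimes>\<^bsub>F\<^esub> (inv_word p \<otimes>\<^bsub>F\<^esub> q) \<in> generate F {p, inv_word p \<otimes>\<^bsub>F\<^esub> q}"
      by (intro generate.eng generate.incl) auto
    moreover have "p \<otimes>\<^bsub>F\<^esub> (inv_word p \<otimes>\<^bsub>F\<^esub> q) = q"
      using F.mult_inv_cancel(2)[of p q] c by simp
    ultimately show "q \<in> generate F {p, inv_word p \<otimes>\<^bsub>F\<^esub> q}" by simp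
  qed (use that carr in \<open>auto intro: generate.incl\<close>)
  have P_quot: "P p q" if "gp p q" "P p (inv_word p \<otimes>\<^bsub>F\<^esub> q)" for p q
  proof -
    have c: "p \<in> carrier F" "q \<in> carrier F" "inv_word p \<in> carrier F"
      using carr[OF that(1)] F.inv_closed[of p] by simp_all
    have "p \<otimes>\<^bsub>F\<^esub> (inv_word p \<otimes>\<^bsub>F\<^esub> q) = q"
      using F.mult_inv_cancel(2)[of p q] c by simp
    then show ?thesis using mult[of p "inv_word p \<otimes>\<^bsub>F\<^esub> q"] c that(2) by simp
  qed
  have P_inv: "P p q" if "gp p q" "P (inv_word p) q" for p q
    using inv[of "inv_word p" q] that carr[OF that(1)] carr[OF gp_inv[OF that(1)]] by simp
  show ?thesis
    using u v gen
  proof (induction "length u + length v" arbitrary: u v rule: less_induct)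
    case less
    have IH: "P p q" if "gp p q" "length p + length q < length u + length v" for p q
      using less.hyps that by (simp add: gp_def)
    have main: "P u v" if uv: "gp u v" and le: "length u \<le> length v"
        and IH: "\<And>p q. gp p q \<Longrightarrow> length p + length q < length u + length v \<Longrightarrow> P p q" for u v
    proof -
      note uv_carr = carr[OF uv]
      define S where "S = {u, inv_word u, v, inv_word v}"
      have sign_gp: "gp p q" and sign_P: "P p q \<Longrightarrow> P u v"
        if "p \<in> {u, inv_word u}" "q \<in> {v, inv_word v}" for p q
      proof -
        have "gp u v" "gp (inv_word u) v" "gp u (inv_word v)" "gp (inv_word u) (inv_word v)"
          using uv gp_inv gp_swap by blast+
        with that show "gp p q" by auto
        have "P u (inv_word v) \<Longrightarrow> P u v"
          using P_inv[OF gp_swap[OF uv]] swap carr uv gp_inv gp_swap by meson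
        moreover have "P (inv_word u) v \<Longrightarrow> P u v"
          using P_inv[OF uv] .
        moreover have "P (inv_word u) (inv_word v) \<Longrightarrow> P u (inv_word v)"
          using P_inv \<open>gp u (inv_word v)\<close> .
        ultimately show "P p q \<Longrightarrow> P u v" using that by auto
      qed
      \<comment> \<open>Conjugation by the common first letter shortens one word of the pair without
        lengthening the other.\<close>
      have conj_red: "P p q"
        if pq: "gp p q" and len: "length p + length q \<le> length u + length v"
          and ne: "p \<noteq> []" "q \<noteq> []" and hd: "hd q = hd p"
          and last: "last p = inv_letter (hd p) \<or> last q = inv_letter (hd p)" for p q
      proof -
        define e where "e = hd p"
        obtain m m' where m: "p = e # m" "q = e # m'"
          using ne hd by (metis e_def list.collapse)
        have e: "[e] \<in> carrier F"
          using carr[OF pq] by (auto simp: m F_def carrier_free_group_iff reduced_def)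
        then have ie: "inv_word [e] \<in> carrier F" using F.inv_closed[of "[e]"] by simp
        define c where "c w = inv_word [e] \<otimes>\<^bsub>F\<^esub> w \<otimes>\<^bsub>F\<^esub> inv\<^bsub>F\<^esub> (inv_word [e])" for w
        have c_eq: "c w = foldr push_letter (foldr push_letter (inv_word [e]) w) [e]" for w
          using ie by (simp add: c_def F_mult)
        have c_inv: "[e] \<otimes>\<^bsub>F\<^esub> c w \<otimes>\<^bsub>F\<^esub> inv\<^bsub>F\<^esub> [e] = w" if "w \<in> carrier F" for w
          using that e ie F.r_inv[OF e] F.mult_inv_cancel(2)[OF e, of w]
          by (simp add: c_def F.m_assoc)
        have "gp (c p) (c q)"
          using F.generate_conjugates[of p q "inv_word [e]"] pq ie e by (simp add: gp_def c_def)
        moreover have "length (c p) + length (c q) < length u + length v"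
          using conj_letter[OF m(1)] conj_letter[OF m(2)] last len e_def
          by (fastforce simp: c_eq)
        ultimately have "P (c p) (c q)" by (rule IH)
        then have "P ([e] \<otimes>\<^bsub>F\<^esub> c p \<otimes>\<^bsub>F\<^esub> inv\<^bsub>F\<^esub> [e]) ([e] \<otimes>\<^bsub>F\<^esub> c q \<otimes>\<^bsub>F\<^esub> inv\<^bsub>F\<^esub> [e])"
          using conj carr[OF \<open>gp (c p) (c q)\<close>] e by blast
        then show ?thesis using c_inv carr[OF pq] by simp
      qed
      \<comment> \<open>A letter can only be represented by a member of a Nielsen-reduced family, so
        the pair consists of the two generators up to order and inversion. The empty word is removed
        because it violates the strict inequality.\<close>
      have reduced_case: "P u v"
        if half: "\<And>s t. s \<in> S - {[]} \<Longrightarrow> t \<in> S - {[]} \<Longrightarrow> s \<noteq> t \<Longrightarrow> 2 * lcp s t \<le> length s"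
          and both: "\<And>s t t'. s \<in> S - {[]} \<Longrightarrow> t \<in> S - {[]} \<Longrightarrow> t' \<in> S - {[]} \<Longrightarrow> s \<noteq> t \<Longrightarrow>
            t' \<noteq> inv_word s \<Longrightarrow> lcp s t + lcp (inv_word s) t' < length s"
      proof -
        have S_carr: "S - {[]} \<subseteq> carrier F"
          using uv_carr F.inv_closed[of u] F.inv_closed[of v] by (auto simp: S_def)
        have S_inv: "inv_word s \<in> S - {[]}" if "s \<in> S - {[]}" for s
          using that by (auto simp: S_def)
        have S_red: "reduced s \<and> s \<noteq> [] \<and> inv_word s \<in> S - {[]}" if "s \<in> S - {[]}" for s
          using that S_carr S_inv[OF that] by (auto simp: F_def carrier_free_group_iff)
        have incl: "x \<in> generate F (S - {[]})" if "x \<in> S" for x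
          using that generate.one[of F "S - {[]}"] generate.incl[of x "S - {[]}" F]
          by (cases "x = []") (auto simp: F_def one_free_group)
        have S_gen: "generate F (S - {[]}) = carrier F"
          by (rule F.generate_eq_carrierI[of "{u, v}"]) (use uv S_carr incl in \<open>auto simp: gp_def S_def\<close>)
        have letter: "[(x, True)] \<in> S - {[]}" if "x \<in> {a, b}" for x
        proof -
          have "[(x, True)] \<in> generate F (S - {[]})"
            using that S_gen letter_closed[of x "{a, b}" True] by (simp add: F_def)
          then obtain s where s: "nielsen_word (S - {[]}) s [(x, True)]"
            using generate_nielsen_word[of "S - {[]}" "{a, b}"] S_carr S_inv unfolding F_def by blast
          show ?thesis
            by (rule nielsen_word_length_one[OF S_red half both s]) auto
        qed
        have neq: "[(b, True)] \<noteq> [(a, True)]" "[(b, True)] \<noteq> inv_word [(a, True)]"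
          using ab by (auto simp: inv_word_def inv_letter_def)
        have "\<not> ([(a, True)] \<in> {w, inv_word w} \<and> [(b, True)] \<in> {w, inv_word w})" for w
          using neq by (metis empty_iff insert_iff inv_word_inv_word)
        then have "[(a, True)] \<in> {u, inv_word u} \<and> [(b, True)] \<in> {v, inv_word v} \<or>
          [(b, True)] \<in> {u, inv_word u} \<and> [(a, True)] \<in> {v, inv_word v}"
          using letter[of a] letter[of b] unfolding S_def by blast
        moreover have "P [(b, True)] [(a, True)]"
          using swap[OF _ _ base] letter_closed[of _ "{a, b}" True] by (simp add: F_def)
        ultimately show ?thesis using sign_P base by blast
      qed
      have strict_case: "P u v"
        if strict: "\<And>s t. s \<in> S - {[]} \<Longrightarrow> t \<in> S - {[]} \<Longrightarrow> s \<noteq> t \<Longrightarrow> 2 * lcp s t < length s"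
      proof (rule reduced_case)
        show "2 * lcp s t \<le> length s" if "s \<in> S - {[]}" "t \<in> S - {[]}" "s \<noteq> t" for s t
          using strict[OF that] by simp
        show "lcp s t + lcp (inv_word s) t' < length s"
          if "s \<in> S - {[]}" "t \<in> S - {[]}" "t' \<in> S - {[]}" "s \<noteq> t" "t' \<noteq> inv_word s" for s t t'
        proof -
          have "inv_word s \<in> S - {[]}" using that(1) by (auto simp: S_def)
          then have "2 * lcp (inv_word s) t' < length s"
            using strict[of "inv_word s" t'] that(3,5) by simp
          with strict[OF that(1,2,4)] show ?thesis by linarith
        qed
      qed
      show ?thesis
      proof (cases "u = []")
        case True
        \<comment> \<open>With \<open>u\<close> empty both letters would have to lie in
          \<open>{v, inv_word v}\<close>; the argument for reduced pairs refutes this as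
          well.\<close>
        then have S: "S - {[]} = {v, inv_word v} - {[]}" by (auto simp: S_def)
        have "2 * lcp s t < length s" if "s \<in> S - {[]}" "t \<in> S - {[]}" "s \<noteq> t" for s t
          using that lcp_inv_word[OF uv_carr(4)] lcp_commute[of v "inv_word v"] unfolding S by auto
        then show ?thesis by (rule strict_case)
      next
        case False
        then have ne: "u \<noteq> []" "v \<noteq> []" using le by auto
        have self: "2 * lcp u (inv_word u) < length u" "2 * lcp v (inv_word v) < length v"
          using lcp_inv_word uv_carr(3,4) ne by auto
        \<comment> \<open>Overlaps of signed copies are compared with half of the shorter word
          \<open>u\<close>: beyond half, \<open>inv_word p\<close> times \<open>q\<close> is shorter
          than \<open>q\<close>.\<close>
        consider (long) p q where "p \<in> {u, inv_word u}" "q \<in> {v, inv_word v}" "length u < 2 * lcp p q"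
          | (tie) p q where "p \<in> {u, inv_word u}" "q \<in> {v, inv_word v}" "length u = 2 * lcp p q"
            "\<And>p q. p \<in> {u, inv_word u} \<Longrightarrow> q \<in> {v, inv_word v} \<Longrightarrow> 2 * lcp p q \<le> length u"
          | (short) "\<And>p q. p \<in> {u, inv_word u} \<Longrightarrow> q \<in> {v, inv_word v} \<Longrightarrow> 2 * lcp p q < length u"
          by (metis linorder_neqE_nat not_less)
        then show ?thesis
        proof cases
          case long
          have pq: "gp p q" using sign_gp long by blast
          have "length (inv_word p \<otimes>\<^bsub>F\<^esub> q) + 2 * lcp p q = length p + length q"
            using length_inv_word_mult[of p q] carr[OF pq] by (simp add: F_mult)
          moreover have "length p = length u" "length q = length v" using long by auto
          ultimately have "P p (inv_word p \<otimes>\<^bsub>F\<^esub> q)"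
            using long gp_quot[OF pq] by (intro IH) auto
          then show ?thesis using P_quot[OF pq] sign_P long by blast
        next
          case short
          have "2 * lcp s t < length s" if st: "s \<in> S - {[]}" "t \<in> S - {[]}" "s \<noteq> t" for s t
          proof -
            have s: "s \<in> {u, inv_word u} \<or> s \<in> {v, inv_word v}"
              and t: "t \<in> {u, inv_word u} \<or> t \<in> {v, inv_word v}"
              using st by (auto simp: S_def)
            show ?thesis
            proof (cases "s \<in> {u, inv_word u} \<longleftrightarrow> t \<in> {u, inv_word u}")
              case True
              with s t st(3) have "s \<in> {u, inv_word u} \<and> t = inv_word s \<or> s \<in> {v, inv_word v} \<and> t = inv_word s"
                by auto
              with self show ?thesis
                by (auto simp: lcp_commute[of u] lcp_commute[of v])
            next
              case False
              with s t short[of s t] short[of t s] show ?thesis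
                using le by (auto simp: lcp_commute[of t s])
            qed
          qed
          then show ?thesis by (rule strict_case)
        next
          case tie
          \<comment> \<open>Multiplication keeps the total length here. The common first letter is
            used instead: if one of the words ends in its inverse, conjugation shortens the
            pair.\<close>
          have pq: "gp p q" using sign_gp tie by blast
          have len: "length p = length u" "length q = length v" using tie by auto
          have pq_ne: "p \<noteq> []" "q \<noteq> []" using tie ne by auto
          have "0 < length u" using ne by simp
          then have "0 < lcp p q" using tie(3) by simp
          then have hd: "hd q = hd p" by (simp add: lcp_pos_iff)
          show ?thesis
          proof (cases "lcp p (inv_word p) = 0 \<and> lcp q (inv_word q) = 0 \<and>
              lcp p (inv_word q) = 0 \<and> lcp (inv_word p) q = 0")
            case False
            then have "0 < lcp p (inv_word p) \<or> 0 < lcp q (inv_word q) \<or>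
                0 < lcp p (inv_word q) \<or> 0 < lcp (inv_word p) q"
              by simp
            then have "hd p = inv_letter (last p) \<or> hd p = inv_letter (last q)"
              using hd pq_ne by (auto simp: lcp_pos_iff hd_inv_word)
            then have "last p = inv_letter (hd p) \<or> last q = inv_letter (hd p)"
              by (metis inv_letter_inv_letter)
            then have "P p q" using conj_red[OF pq _ pq_ne hd] len by simp
            then show ?thesis using sign_P tie by blast
          next
            case zero: True
            show ?thesis
            proof (cases "lcp (inv_word p) (inv_word q) = 0")
              case False
              then have "0 < lcp (inv_word p) (inv_word q)" by simp
              then have "inv_letter (last q) = inv_letter (last p)"
                using pq_ne by (simp add: lcp_pos_iff hd_inv_word)
              then have last: "last q = last p" by (metis inv_letter_inv_letter)
              \<comment> \<open>\<open>p\<close> and \<open>q\<close> share their first and their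
                last letter. The quotient \<open>?r\<close> is as long as \<open>q\<close>, begins
                like \<open>inv_word p\<close> and ends in the inverse of that letter, so
                conjugation shortens the pair of \<open>inv_word p\<close> and
                \<open>?r\<close>.\<close>
              let ?k = "lcp p q" and ?r = "inv_word p \<otimes>\<^bsub>F\<^esub> q"
              have r: "?r = inv_word (drop ?k p) @ drop ?k q"
                using carr[OF pq] by (simp add: F_mult inv_word_mult)
              have k: "?k < length p" "?k < length q" using \<open>0 < length u\<close> tie(3) len le by auto
              have "hd ?r = hd (inv_word p)" "last ?r = last q" "?r \<noteq> []"
                using k pq_ne by (simp_all add: r hd_append hd_inv_word last_append)
              moreover have "gp (inv_word p) ?r"
                using gp_quot[OF pq] gp_inv by blast
              moreover have "length ?r = length v"
                using length_inv_word_mult[of p q] carr[OF pq] tie(3) len by (simp add: F_mult)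
              ultimately have "P (inv_word p) ?r"
                using pq_ne last len by (intro conj_red) (simp_all add: hd_inv_word)
              then have "P p q"
                using P_quot[OF pq] P_inv[OF gp_quot[OF pq]] by blast
              then show ?thesis using sign_P tie by blast
            next
              case True
              \<comment> \<open>The only remaining overlap is at the front of \<open>p\<close> and
                \<open>q\<close>. No member can lose letters at both ends, so the pair is reduced
                despite the tie.\<close>
              have S: "S = {p, inv_word p, q, inv_word q}"
                using tie(1,2) by (auto simp: S_def)
              have half: "2 * lcp p q \<le> length p" "2 * lcp p q \<le> length q"
                using tie(3) len le by auto
              have lt: "lcp p q < length p" "lcp p q < length q" "lcp q p < length p" "lcp q p < length q"
                using \<open>0 < length u\<close> tie(3) len le by (auto simp: lcp_commute[of q p])
              have lcp_S: "lcp s t = 0 \<or> s = p \<and> t = q \<or> s = q \<and> t = p"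
                if "s \<in> S" "t \<in> S" "s \<noteq> t" for s t
                using that zero True unfolding S by (auto simp: lcp_commute)
              have "inv_word p \<noteq> q"
                using lcp_inv_word[of p] carr[OF pq] pq_ne half tie(3) len by auto
              then have ipq: "inv_word p \<noteq> q" "inv_word q \<noteq> p" "inv_word p \<noteq> p" "inv_word q \<noteq> q"
                using lcp_inv_word[of p] lcp_inv_word[of q] carr[OF pq] pq_ne by auto
              show ?thesis
              proof (rule reduced_case)
                show "2 * lcp s t \<le> length s"
                  if "s \<in> S - {[]}" "t \<in> S - {[]}" "s \<noteq> t" for s t
                  using lcp_S[of s t] that half lcp_commute[of p q] by auto
                show "lcp s t + lcp (inv_word s) t' < length s"
                  if "s \<in> S - {[]}" "t \<in> S - {[]}" "t' \<in> S - {[]}" "s \<noteq> t" "t' \<noteq> inv_word s" for s t t'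
                proof -
                  have "inv_word s \<in> S" "0 < length s" using that by (auto simp: S)
                  then show ?thesis
                    using lcp_S[of s t] lcp_S[of "inv_word s" t'] that ipq lt
                    by auto
                qed
              qed
            qed
          qed
        qed
      qed
    qed
    have uv: "gp u v" using less.prems by (simp add: gp_def)
    show ?case
    proof (cases "length u \<le> length v")
      case True
      show ?thesis by (rule main[OF uv True IH])
    next
      case False
      then have le: "length v \<le> length u" by simp
      have "P v u"
        by (rule main[OF gp_swap[OF uv] le IH]) simp_all
      then show ?thesis using swap less.prems by blast
    qed
  qed
qed

section \<open>Bases of free groups of rank two\<close>

lemma free_group_hom_extend:
  assumes "group G" and g: "\<And>x. x \<in> X \<Longrightarrow> g x \<in> carrier G"
  shows "\<exists>h \<in> hom (free_group X) G. \<forall>x\<in>X. h [(x, True)] = g x"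
proof -
  interpret group G by fact
  let ?f = "\<lambda>(x, e). if e then g x else inv\<^bsub>G\<^esub> g x"
  have "word_hom G ?f \<in> hom (free_group X) G"
    by (rule word_hom_hom) (use g in \<open>auto simp: inv_letter_def monoid_axioms\<close>)
  then show ?thesis using g by (intro bexI[of _ "word_hom G ?f"]) auto
qed

lemma generate_basis:
  assumes G: "group G" and B: "is_basis G B"
  shows "generate G B = carrier G"
proof
  interpret group G by fact
  have sub: "subgroup (generate G B) G"
    using B by (intro generate_is_subgroup) (simp add: is_basis_def)
  have "eval_word G w \<in> generate G B" if "w \<in> lists (B \<times> UNIV)" for w
    using that
  proof induction
    case (Cons a w)
    then have "(if snd a then fst a else inv\<^bsub>G\<^esub> fst a) \<in> generate G B"
      by (auto intro: generate.incl generate.inv)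
    with Cons.IH show ?case
      by (auto simp: eval_word_eq_word_hom case_prod_unfold intro: generate.eng)
  qed (simp add: eval_word_eq_word_hom generate.one)
  moreover have "carrier G = eval_word G ` carrier (free_group B)"
    using B by (simp add: is_basis_def iso_def bij_betw_def)
  ultimately show "carrier G \<subseteq> generate G B"
    by (auto simp: carrier_free_group_iff)
  show "generate G B \<subseteq> carrier G"
    using sub subgroup.subset by blast
qed

text \<open>A subset \<open>S\<close> of the basis gives the homomorphism to the group of order two that sends exactly
  the elements of \<open>S\<close> to the nontrivial element. There are at most four homomorphisms.\<close>

lemma card_basis_le_two:
  assumes B: "is_basis (free_group {a, b}) B"
  shows "finite B \<and> card B \<le> 2"
proof -
  let ?F = "free_group {a, b}" and ?FB = "free_group B"
  define M :: "bool monoid" where "M = \<lparr>carrier = UNIV, mult = (\<noteq>), one = False\<rparr>"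
  have M: "group M" by (rule groupI) (auto simp: M_def)
  define h where "h = eval_word ?F"
  define g where "g = inv_into (carrier ?FB) h"
  interpret F: group ?F by (rule group_free_group)
  interpret FB: group ?FB by (rule group_free_group)
  have h: "h \<in> iso ?FB ?F" and B_carr: "B \<subseteq> carrier ?F"
    using B by (auto simp: h_def is_basis_def)
  then have g: "g \<in> hom ?F ?FB"
    using FB.iso_set_sym iso_imp_homomorphism unfolding g_def by blast
  have g_basis: "g c = [(c, True)]" if "c \<in> B" for c
  proof -
    have "h [(c, True)] = c"
      using that B_carr by (auto simp: h_def eval_word_eq_word_hom)
    moreover have "inj_on h (carrier ?FB)" using h by (simp add: iso_def bij_betw_def)
    ultimately show ?thesis
      unfolding g_def using letter_closed[OF that] inv_into_f_f by metis
  qed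
  define \<chi> where "\<chi> S = word_hom M (\<lambda>a. fst a \<in> S)" for S :: "('a \<times> bool) list set"
  have \<chi>: "\<chi> S \<circ> g \<in> hom ?F M" for S
  proof (rule hom_compose[OF g])
    show "\<chi> S \<in> hom ?FB M"
      unfolding \<chi>_def
      by (rule word_hom_hom) (use M in \<open>auto simp: M_def inv_letter_def group.is_monoid\<close>)
  qed
  define \<phi> where "\<phi> S = (\<chi> S (g [(a, True)]), \<chi> S (g [(b, True)]))" for S
  have "inj_on \<phi> (Pow B)"
  proof (rule inj_onI)
    fix S T assume ST: "S \<in> Pow B" "T \<in> Pow B" "\<phi> S = \<phi> T"
    have eq: "\<chi> S (g w) = \<chi> T (g w)" if "w \<in> carrier ?F" for w
    proof -
      have "(\<chi> S \<circ> g) w = (\<chi> T \<circ> g) w"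
      proof (rule hom_free_group_eqI[OF M \<chi> \<chi> _ that])
        fix c assume "c \<in> {a, b}"
        then show "(\<chi> S \<circ> g) [(c, True)] = (\<chi> T \<circ> g) [(c, True)]"
          using ST(3) by (auto simp: \<phi>_def)
      qed
      then show ?thesis by simp
    qed
    have "\<chi> S [(c, True)] = \<chi> T [(c, True)]" if "c \<in> B" for c
      using eq[of c] g_basis[OF that] subsetD[OF B_carr that] by simp
    then show "S = T" using ST(1,2) by (auto simp: \<chi>_def M_def)
  qed
  moreover have "finite (\<phi> ` Pow B)" by (rule finite_subset[OF subset_UNIV]) simp
  ultimately have "finite (Pow B)" by (metis finite_imageD)
  moreover have "card (Pow B) \<le> card (UNIV :: (bool \<times> bool) set)"
    by (rule card_inj_on_le[OF \<open>inj_on \<phi> (Pow B)\<close>]) simp_all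
  then have "card (Pow B) \<le> 2 ^ 2"
    by (simp add: card_cartesian_product flip: UNIV_Times_UNIV)
  ultimately have "finite B" "2 ^ card B \<le> (2 ^ 2 :: nat)"
    by (simp_all add: card_Pow)
  then show ?thesis using power_le_imp_le_exp[of "2 :: nat" "card B" 2] by simp
qed

text \<open>This opens primitive words to Nielsen reduction. A basis consisting of \<open>w\<close>
  alone is covered by taking \<open>v = w\<close>.\<close>

lemma primitive_generating_pair:
  assumes "primitive (free_group {a, b}) w"
  shows "w \<in> carrier (free_group {a, b})"
    and "\<exists>v \<in> carrier (free_group {a, b}).
      generate (free_group {a, b}) {w, v} = carrier (free_group {a, b})"
proof -
  obtain B where B: "is_basis (free_group {a, b}) B" "w \<in> B"
    using assms by (auto simp: primitive_def)
  then show "w \<in> carrier (free_group {a, b})" by (auto simp: is_basis_def)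
  have fin: "finite B" "card (B - {w}) \<le> 1" using card_basis_le_two[OF B(1)] B(2) by auto
  obtain v where "v \<in> B" "B = {w, v}"
  proof (cases "B = {w}")
    case False
    then obtain v where "v \<in> B - {w}" using B(2) by blast
    with fin have "B - {w} = {v}" by (auto simp: card_le_Suc0_iff_eq)
    with that[of v] B(2) \<open>v \<in> B - {w}\<close> show ?thesis by blast
  qed (use that[of w] in simp)
  moreover have "B \<subseteq> carrier (free_group {a, b})" using B(1) by (simp add: is_basis_def)
  ultimately show "\<exists>v \<in> carrier (free_group {a, b}).
      generate (free_group {a, b}) {w, v} = carrier (free_group {a, b})"
    using generate_basis[OF group_free_group B(1)] by auto
qed

section \<open>Primitive words from transvections\<close>

lemma (in group) mult_int_pow_cancel:
  fixes k :: int
  assumes "x \<in> carrier G" "y \<in> carrier G"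
  shows "x \<otimes> y [^] k \<otimes> y [^] (- k) = x" "x \<otimes> y [^] (- k) \<otimes> y [^] k = x"
  using assms by (simp_all add: m_assoc int_pow_neg)

lemma is_basis_transvection:
  fixes k :: int
  assumes "a \<noteq> b"
  defines "F \<equiv> free_group {a, b}"
  shows "is_basis F {[(a, True)] \<otimes>\<^bsub>F\<^esub> [(b, True)] [^]\<^bsub>F\<^esub> k, [(b, True)]}"
proof -
  define x y where "x = [(a, True)]" and "y = [(b, True)]"
  define u where "u = x \<otimes>\<^bsub>F\<^esub> y [^]\<^bsub>F\<^esub> k"
  let ?B = "{u, y}"
  let ?FB = "free_group ?B"
  let ?U = "[(u, True)]" and ?Y = "[(y, True)]"
  interpret F: group F unfolding F_def by (rule group_free_group)
  interpret FB: group ?FB by (rule group_free_group)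
  have xy: "x \<in> carrier F" "y \<in> carrier F"
    unfolding F_def x_def y_def by (simp_all add: letter_closed)
  then have u: "u \<in> carrier F" by (simp add: u_def)
  have UY: "?U \<in> carrier ?FB" "?Y \<in> carrier ?FB" by (simp_all add: letter_closed)
  define h where "h = eval_word F"
  have h: "h \<in> hom ?FB F" unfolding h_def by (rule eval_word_hom) (use u xy F.is_group in auto)
  interpret h: group_hom ?FB F h by unfold_locales (rule h)
  have hU: "h ?U = u" "h ?Y = y"
    using u xy by (simp_all add: h_def eval_word_eq_word_hom)
  \<comment> \<open>The inverse substitution: \<open>u = x y^k\<close> solved for
    \<open>x\<close>.\<close>
  define f where "f c = (if c = a then ?U \<otimes>\<^bsub>?FB\<^esub> ?Y [^]\<^bsub>?FB\<^esub> (- k) else ?Y)" for c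
  have "f c \<in> carrier ?FB" for c using UY by (simp add: f_def)
  then obtain g where g: "g \<in> hom F ?FB" and "\<forall>c\<in>{a, b}. g [(c, True)] = f c"
    using free_group_hom_extend[OF FB.is_group, of "{a, b}" f] unfolding F_def by blast
  then have gx: "g x = ?U \<otimes>\<^bsub>?FB\<^esub> ?Y [^]\<^bsub>?FB\<^esub> (- k)" and gy: "g y = ?Y"
    using assms(1) by (simp_all add: f_def x_def y_def)
  interpret g: group_hom F ?FB g by unfold_locales (rule g)
  have "g u = g x \<otimes>\<^bsub>?FB\<^esub> g y [^]\<^bsub>?FB\<^esub> k" using xy by (simp add: u_def g.hom_int_pow)
  then have gu: "g u = ?U" using FB.mult_int_pow_cancel[OF UY] by (simp only: gx gy)
  have "h (g x) = h ?U \<otimes>\<^bsub>F\<^esub> h ?Y [^]\<^bsub>F\<^esub> (- k)"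
    using UY by (simp add: gx h.hom_int_pow)
  then have hgx: "h (g x) = x" using F.mult_int_pow_cancel[OF xy] by (simp only: hU) (simp add: u_def)
  have id: "id \<in> hom G G" for G :: "('c, 'd) monoid_scheme" by (simp add: hom_def)
  have gh: "g (h w) = w" if w: "w \<in> carrier ?FB" for w
  proof -
    have "(g \<circ> h) w = id w"
    proof (rule hom_free_group_eqI[OF FB.is_group hom_compose[OF h g] id _ w])
      fix c assume "c \<in> {u, y}"
      then show "(g \<circ> h) [(c, True)] = id [(c, True)]" by (auto simp: hU gu gy)
    qed
    then show ?thesis by simp
  qed
  have hg: "h (g w) = w" if w: "w \<in> carrier F" for w
  proof -
    have "(h \<circ> g) w = id w"
    proof (rule hom_free_group_eqI[of F "h \<circ> g" "{a, b}" id w])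
      fix c assume "c \<in> {a, b}"
      then show "(h \<circ> g) [(c, True)] = id [(c, True)]"
        using hgx gy hU(2) by (auto simp: x_def y_def)
    qed (use hom_compose[OF g h] w F.is_group id in \<open>simp_all add: F_def\<close>)
    then show ?thesis by simp
  qed
  have "bij_betw h (carrier ?FB) (carrier F)"
    by (rule bij_betw_byWitness[where f' = g]) (use gh hg in auto)
  with h have "h \<in> iso ?FB F" by (simp add: iso_def)
  then show ?thesis
    using u xy by (simp add: is_basis_def h_def u_def x_def y_def)
qed

text \<open>The exponents 0, 1 and -1 supply the primitive words whose powers define the finite
  quotients.\<close>

lemma primitive_transvection:
  fixes k :: int
  assumes "a \<noteq> b"
  defines "F \<equiv> free_group {a, b}"
  shows "primitive F ([(a, True)] \<otimes>\<^bsub>F\<^esub> [(b, True)] [^]\<^bsub>F\<^esub> k)" and "primitive F [(b, True)]"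
  using is_basis_transvection[OF assms(1), of k] unfolding primitive_def F_def by blast+

section \<open>Heisenberg groups and finite Burnside groups\<close>

fun heis_mult :: "nat \<Rightarrow> nat \<Rightarrow> nat \<times> nat \<times> nat \<Rightarrow> nat \<times> nat \<times> nat \<Rightarrow> nat \<times> nat \<times> nat" where
  "heis_mult d e (a, b, c) (a', b', c') = ((a + a') mod d, (b + b') mod d, (c + c' + b * a') mod e)"

text \<open>The triple \<open>(a, b, c)\<close> stands for \<open>x\<^sup>a y\<^sup>b z\<^sup>c\<close> where \<open>z\<close> is central and \<open>y x = x y z\<close>.\<close>

definition heisenberg :: "nat \<Rightarrow> nat \<Rightarrow> (nat \<times> nat \<times> nat) monoid" where
  "heisenberg d e = \<lparr>carrier = {..<d} \<times> {..<d} \<times> {..<e}, mult = heis_mult d e, one = (0, 0, 0)\<rparr>"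

lemma order_heisenberg: "order (heisenberg d e) = d * d * e"
  by (simp add: order_def heisenberg_def card_cartesian_product)

text \<open>Coordinates known modulo \<open>d\<close> enter the central coordinate, which is taken
  modulo \<open>e\<close>; divisibility makes this consistent.\<close>

lemma mod_add_mod_mult_eq:
  fixes d e :: nat
  assumes "e dvd d"
  shows "(u + (m mod d) * v) mod e = (u + m * v) mod e"
proof -
  have "((m mod d) * v) mod e = (m * v) mod e"
    using mod_mod_cancel[OF assms, of m] by (metis mod_mult_left_eq)
  then show ?thesis by (metis mod_add_right_eq)
qed

lemma heis_mult_assoc:
  assumes "e dvd d"
  shows "heis_mult d e (heis_mult d e p q) t = heis_mult d e p (heis_mult d e q t)"
proof -
  note drop_left = mod_add_mod_mult_eq[OF assms]
  have drop_right: "(u + v * (m mod d)) mod e = (u + v * m) mod e" for m u v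
    using drop_left[of u m v] by (simp add: mult.commute)
  obtain a b c a' b' c' a'' b'' c'' where
    pqt: "p = (a, b, c)" "q = (a', b', c')" "t = (a'', b'', c'')"
    by (metis prod_cases3)
  have "((c + c' + b * a') mod e + c'' + (b + b') mod d * a'') mod e =
      ((c + c' + b * a') mod e + c'' + (b + b') * a'') mod e"
    by (rule drop_left)
  also have "\<dots> = (c + c' + b * a' + c'' + (b + b') * a'') mod e"
    by (simp add: mod_add_left_eq add.assoc)
  also have "\<dots> = (c + (c' + c'' + b' * a'') + b * (a' + a'')) mod e"
    by (simp add: algebra_simps)
  also have "\<dots> = (c + (c' + c'' + b' * a'') mod e + b * (a' + a'')) mod e"
    by (metis mod_add_left_eq mod_add_right_eq)
  also have "\<dots> = (c + (c' + c'' + b' * a'') mod e + b * ((a' + a'') mod d)) mod e"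
    by (rule drop_right[symmetric])
  finally show ?thesis
    by (simp add: pqt mod_add_left_eq mod_add_right_eq add.assoc)
qed

lemma group_heisenberg:
  assumes d: "0 < d" and e: "0 < e" "e dvd d"
  shows "group (heisenberg d e)"
proof (rule groupI)
  fix p assume "p \<in> carrier (heisenberg d e)"
  then obtain a b c where p: "p = (a, b, c)" "a < d" "b < d" "c < e"
    by (auto simp: heisenberg_def)
  define b' where "b' = (d - b) mod d"
  define m where "m = (c + b' * a) mod e"
  have "m < e" using e by (simp add: m_def)
  have "((e - m) mod e + c + b' * a) mod e = ((e - m) + m) mod e"
    unfolding m_def by (metis add.assoc mod_add_eq mod_add_left_eq mod_mod_trivial)
  then have "((e - m) mod e + c + b' * a) mod e = 0" using \<open>m < e\<close> by simp
  then have "heis_mult d e ((d - a) mod d, b', (e - m) mod e) p = (0, 0, 0)"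
    using p by (simp add: b'_def mod_add_left_eq)
  then show "\<exists>q\<in>carrier (heisenberg d e). q \<otimes>\<^bsub>heisenberg d e\<^esub> p = \<one>\<^bsub>heisenberg d e\<^esub>"
    using d e by (intro bexI[of _ "((d - a) mod d, b', (e - m) mod e)"])
      (simp_all add: heisenberg_def b'_def)
qed (use assms in \<open>auto simp: heisenberg_def heis_mult_assoc\<close>)

text \<open>Each of the \<open>n choose 2\<close> pairs of factors makes one \<open>y^b\<close> pass
  one \<open>x^a\<close>, at the cost of \<open>z^(a*b)\<close>. Hence the exponent divides
  \<open>d\<close> once \<open>e\<close> divides both \<open>d\<close> and
  \<open>d choose 2\<close>.\<close>

lemma heisenberg_pow:
  assumes "0 < d" "0 < e" "e dvd d"
  shows "(a, b, c) [^]\<^bsub>heisenberg d e\<^esub> n =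
    ((n * a) mod d, (n * b) mod d, (n * c + (n choose 2) * (a * b)) mod e)"
proof (induction n)
  case 0
  then show ?case by (simp add: heisenberg_def nat_pow_def numeral_2_eq_2)
next
  case (Suc n)
  have "((n * c + (n choose 2) * (a * b)) mod e + c + (n * b) mod d * a) mod e =
      (n * c + (n choose 2) * (a * b) + c + (n * b) * a) mod e"
    unfolding mod_add_mod_mult_eq[OF assms(3)] by (simp add: mod_add_left_eq add.assoc)
  moreover have "Suc n choose 2 = n + (n choose 2)"
    by (simp add: numeral_2_eq_2)
  ultimately have "((n * c + (n choose 2) * (a * b)) mod e + c + (n * b) mod d * a) mod e =
      (Suc n * c + (Suc n choose 2) * (a * b)) mod e"
    by (simp add: algebra_simps)
  with Suc show ?case
    by (simp add: nat_pow_def heisenberg_def mod_add_left_eq mod_add_right_eq add.commute)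
qed

section \<open>Heisenberg relations in an arbitrary group\<close>

context group
begin

lemma nat_pow_mod_eq: "x \<in> carrier G \<Longrightarrow> x [^] d = \<one> \<Longrightarrow> x [^] (n mod d) = x [^] (n :: nat)"
proof -
  assume x: "x \<in> carrier G" "x [^] d = \<one>"
  have "x [^] n = x [^] (d * (n div d) + n mod d)" by simp
  also have "\<dots> = (x [^] d) [^] (n div d) \<otimes> x [^] (n mod d)"
    using x(1) by (simp add: nat_pow_mult nat_pow_pow del: mult_div_mod_eq)
  finally show ?thesis using x by simp
qed

lemma heisenberg_relation_pow:
  fixes a b :: nat
  assumes c: "x \<in> carrier G" "y \<in> carrier G" "z \<in> carrier G"
    and yx: "y \<otimes> x = x \<otimes> y \<otimes> z" and zx: "z \<otimes> x = x \<otimes> z" and zy: "z \<otimes> y = y \<otimes> z"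
  shows "y [^] b \<otimes> x [^] a = x [^] a \<otimes> y [^] b \<otimes> z [^] (b * a)"
proof -
  have zx': "z [^] n \<otimes> x = x \<otimes> z [^] n" and zy': "z [^] n \<otimes> y = y \<otimes> z [^] n" for n :: nat
    using group_commutes_pow zx zy c by simp_all
  have x: "y [^] b \<otimes> x = x \<otimes> y [^] b \<otimes> z [^] b" for b :: nat
  proof (induction b)
    case (Suc b)
    have "y [^] Suc b \<otimes> x = (y [^] b \<otimes> x) \<otimes> (y \<otimes> z)"
      using c by (simp add: m_assoc yx)
    also have "\<dots> = x \<otimes> y [^] b \<otimes> (z [^] b \<otimes> y) \<otimes> z"
      using c by (simp add: Suc m_assoc)
    also have "\<dots> = x \<otimes> y [^] Suc b \<otimes> z [^] Suc b"
      using c by (simp add: zy' m_assoc)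
    finally show ?case .
  qed (use c in simp)
  show ?thesis
  proof (induction a)
    case (Suc a)
    have "y [^] b \<otimes> x [^] Suc a = (y [^] b \<otimes> x [^] a) \<otimes> x"
      using c by (simp add: m_assoc)
    also have "\<dots> = x [^] a \<otimes> y [^] b \<otimes> (z [^] (b * a) \<otimes> x)"
      using c by (simp add: Suc m_assoc)
    also have "\<dots> = x [^] a \<otimes> (y [^] b \<otimes> x) \<otimes> z [^] (b * a)"
      using c by (simp add: zx' m_assoc)
    also have "\<dots> = x [^] Suc a \<otimes> y [^] b \<otimes> (z [^] b \<otimes> z [^] (b * a))"
      using c by (simp add: x m_assoc)
    also have "z [^] b \<otimes> z [^] (b * a) = z [^] (b * Suc a)"
      using c by (simp add: nat_pow_mult)
    finally show ?case .
  qed (use c in simp)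
qed

text \<open>Collecting a product of two normal forms reproduces \<open>heis_mult\<close> before
  reduction; the power relations then permit reduction modulo \<open>d\<close> and
  \<open>e\<close>.\<close>

lemma heisenberg_hom:
  assumes c: "x \<in> carrier G" "y \<in> carrier G" "z \<in> carrier G"
    and yx: "y \<otimes> x = x \<otimes> y \<otimes> z" and zx: "z \<otimes> x = x \<otimes> z" and zy: "z \<otimes> y = y \<otimes> z"
    and powers: "x [^] d = \<one>" "y [^] d = \<one>" "z [^] e = \<one>"
  shows "(\<lambda>(a, b, c). x [^] (a::nat) \<otimes> y [^] (b::nat) \<otimes> z [^] (c::nat)) \<in> hom (heisenberg d e) G"
proof (rule homI)
  fix p q :: "nat \<times> nat \<times> nat"
  obtain a b k a' b' k' where pq: "p = (a, b, k)" "q = (a', b', k')" by (metis prod_cases3)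
  have zy': "z [^] n \<otimes> y [^] m = y [^] m \<otimes> z [^] n" and zx': "z [^] n \<otimes> x [^] m = x [^] m \<otimes> z [^] n"
    for n m :: nat
    using group_commutes_pow[of z x n] group_commutes_pow[of z y n]
      group_commutes_pow[of x "z [^] n" m] group_commutes_pow[of y "z [^] n" m] c zx zy by simp_all
  have zy_left: "z [^] n \<otimes> (y [^] m \<otimes> u) = y [^] m \<otimes> (z [^] n \<otimes> u)"
    if "u \<in> carrier G" for n m :: nat and u
    using that c zy'[of n m] by (simp flip: m_assoc)
  have zz: "z [^] (b * a') \<otimes> (z [^] k \<otimes> z [^] k') = z [^] k \<otimes> (z [^] k' \<otimes> z [^] (b * a'))"
    using c by (simp add: nat_pow_mult ac_simps)
  have "(x [^] a \<otimes> y [^] b \<otimes> z [^] k) \<otimes> (x [^] a' \<otimes> y [^] b' \<otimes> z [^] k') =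
      x [^] a \<otimes> y [^] b \<otimes> (z [^] k \<otimes> x [^] a') \<otimes> y [^] b' \<otimes> z [^] k'"
    using c by (simp add: m_assoc)
  also have "\<dots> = x [^] a \<otimes> (y [^] b \<otimes> x [^] a') \<otimes> (z [^] k \<otimes> y [^] b') \<otimes> z [^] k'"
    using c by (simp add: m_assoc zx')
  also have "\<dots> = x [^] a \<otimes> x [^] a' \<otimes> y [^] b \<otimes> (z [^] (b * a') \<otimes> y [^] b') \<otimes> z [^] k \<otimes> z [^] k'"
    using c by (simp add: m_assoc heisenberg_relation_pow[OF c yx zx zy] zy_left)
  also have "\<dots> = (x [^] a \<otimes> x [^] a') \<otimes> (y [^] b \<otimes> y [^] b') \<otimes>
      (z [^] k \<otimes> z [^] k' \<otimes> z [^] (b * a'))"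
    using c by (simp add: m_assoc zy_left zz)
  also have "\<dots> = x [^] (a + a') \<otimes> y [^] (b + b') \<otimes> z [^] (k + k' + b * a')"
    using c by (simp add: nat_pow_mult)
  also have "\<dots> = x [^] ((a + a') mod d) \<otimes> y [^] ((b + b') mod d) \<otimes> z [^] ((k + k' + b * a') mod e)"
    using c powers by (simp add: nat_pow_mod_eq)
  finally show "(case p \<otimes>\<^bsub>heisenberg d e\<^esub> q of (a, b, c) \<Rightarrow> x [^] a \<otimes> y [^] b \<otimes> z [^] c) =
      (case p of (a, b, c) \<Rightarrow> x [^] a \<otimes> y [^] b \<otimes> z [^] c) \<otimes>
      (case q of (a, b, c) \<Rightarrow> x [^] a \<otimes> y [^] b \<otimes> z [^] c)"
    by (simp add: pq heisenberg_def)
qed (use c in \<open>auto simp: heisenberg_def\<close>)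

text \<open>The exponent \<open>1 mod d\<close> keeps the generators inside the carrier also for
  \<open>d = 1\<close>.\<close>

lemma heisenberg_normal_forms:
  fixes d :: nat
  assumes "x \<in> carrier G" "y \<in> carrier G" "z \<in> carrier G" "x [^] d = \<one>" "y [^] d = \<one>"
  shows "x [^] (1 mod d) \<otimes> y [^] (0::nat) \<otimes> z [^] (0::nat) = x"
    and "x [^] (0::nat) \<otimes> y [^] (1 mod d) \<otimes> z [^] (0::nat) = y"
    and "x [^] (0::nat) \<otimes> y [^] (0::nat) \<otimes> z [^] (0::nat) = \<one>"
  using assms nat_pow_mod_eq[of x d 1] nat_pow_mod_eq[of y d 1] by simp_all

text \<open>The four relations say that the conjugates \<open>a, b, c\<close> of \<open>x\<close> under powers of \<open>y\<close>
  satisfy \<open>a b c = a c b = 1\<close>, so they generate an abelian normal subgroup.\<close>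

lemma heisenberg_relations_of_cubes:
  assumes c: "x \<in> carrier G" "y \<in> carrier G"
    and cubes: "x [^] (3::nat) = \<one>" "y [^] (3::nat) = \<one>" "(x \<otimes> y) [^] (3::nat) = \<one>"
      "(x \<otimes> inv y) [^] (3::nat) = \<one>"
  defines "z \<equiv> inv (x \<otimes> y) \<otimes> (y \<otimes> x)"
  shows "z \<otimes> x = x \<otimes> z" and "z \<otimes> y = y \<otimes> z" and "z [^] (3::nat) = \<one>"
proof -
  define b c where "b = y \<otimes> x \<otimes> inv y" and "c = inv y \<otimes> x \<otimes> y"
  have bc: "b \<in> carrier G" "c \<in> carrier G" using c by (simp_all add: b_def c_def)
  have pow3: "u [^] (3::nat) = u \<otimes> (u \<otimes> u)" if "u \<in> carrier G" for u
    using that by (simp add: numeral_3_eq_3 m_assoc)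
  have yyy: "y \<otimes> (y \<otimes> y) = \<one>" using cubes(2) c by (simp add: pow3)
  have iy: "inv y = y \<otimes> y"
    by (rule inv_equality) (use yyy c in \<open>simp_all add: m_assoc\<close>)
  have iyiy: "inv y \<otimes> inv y = y"
    using yyy c by (simp add: iy m_assoc)
  have yy_left: "y \<otimes> (y \<otimes> u) = inv y \<otimes> u" and iyiy_left: "inv y \<otimes> (inv y \<otimes> u) = y \<otimes> u"
    if "u \<in> carrier G" for u
    using that c iy iyiy by (simp_all flip: m_assoc)
  \<comment> \<open>Since \<open>y^2\<close> is the inverse of \<open>y\<close>, moving all powers
    of \<open>y\<close> to the right turns the cube of \<open>x y\<close> into \<open>x b c\<close>,
    and that of \<open>x y^-1\<close> into \<open>x c b\<close>.\<close>
  have xbc: "x \<otimes> (b \<otimes> c) = \<one>"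
    using cubes(3) c by (simp add: pow3 b_def c_def m_assoc iyiy_left)
  have xcb: "x \<otimes> (c \<otimes> b) = \<one>"
    using cubes(4) c by (simp add: pow3 b_def c_def m_assoc yy_left)
  have "inv b = x \<otimes> c"
    by (rule inv_equality) (use xcb c bc in \<open>simp_all add: m_assoc\<close>)
  moreover have "(c \<otimes> x) \<otimes> b = \<one>"
    by (rule inv_comm) (use inv_comm[OF xbc] c bc in \<open>simp_all add: m_assoc\<close>)
  then have "inv b = c \<otimes> x"
    by (rule inv_equality) (use c bc in simp_all)
  ultimately have cx: "c \<otimes> x = x \<otimes> c" and ib: "inv b = x \<otimes> c" by simp_all
  have "c \<otimes> (c \<otimes> c) = inv y \<otimes> (x [^] (3::nat)) \<otimes> y"
    using c by (simp add: c_def pow3 m_assoc mult_inv_cancel del: cubes)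
  then have ccc: "c \<otimes> (c \<otimes> c) = \<one>" using c by (simp add: cubes)
  have ic: "inv c = c \<otimes> c"
    by (rule inv_equality) (use ccc bc in \<open>simp_all add: m_assoc\<close>)
  have z: "z = inv c \<otimes> x"
    using c by (simp add: z_def c_def inv_mult_group m_assoc)
  have icx: "inv c \<otimes> x = x \<otimes> inv c"
    using bc c by (simp add: ic m_assoc cx) (simp add: cx flip: m_assoc)
  show "z \<otimes> x = x \<otimes> z"
    using bc c by (simp add: z icx m_assoc)
  have "z [^] (3::nat) = inv c [^] (3::nat) \<otimes> x [^] (3::nat)"
    using pow_mult_distrib[OF icx] bc c by (simp add: z)
  also have "inv c [^] (3::nat) = inv (c [^] (3::nat))"
    using bc by (simp add: nat_pow_inv)
  finally show "z [^] (3::nat) = \<one>"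
    using bc cubes ccc by (simp add: pow3)
  \<comment> \<open>Conjugation by \<open>y\<close> permutes \<open>x, b, c\<close> cyclically.
    Moving \<open>y\<close> to the left turns \<open>inv c\<close> into \<open>inv b\<close>, and
    \<open>inv b = x c\<close> brings the remainder back to \<open>z\<close>.\<close>
  have "z \<otimes> y = inv c \<otimes> y \<otimes> c"
    using c bc by (simp add: z m_assoc) (simp add: c_def m_assoc mult_inv_cancel)
  also have "inv c \<otimes> y = y \<otimes> inv b"
    using c by (simp add: c_def b_def inv_mult_group m_assoc yy_left iyiy iy[symmetric])
  also have "y \<otimes> inv b \<otimes> c = y \<otimes> (x \<otimes> (c \<otimes> c))"
    using c bc by (simp add: ib m_assoc)
  also have "x \<otimes> (c \<otimes> c) = z"
    using icx by (simp add: z ic)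
  finally show "z \<otimes> y = y \<otimes> z" .
qed

end

section \<open>Both Burnside groups as quotients by one kernel\<close>

lemma normal_closure_subset_kernel:
  assumes "group_hom G H h" "R \<subseteq> kernel G H h"
  shows "normal_closure G R \<subseteq> kernel G H h"
  using group_hom.normal_kernel[OF assms(1)] assms(2) by (auto simp: normal_closure_def)

text \<open>The closure of primitive powers lies in that of all powers, and this in the kernel of
  \<open>h\<close>. For the converse, \<open>relations\<close> produces a map from the Heisenberg
  group through which the projection modulo the primitive powers factors. The type of
  \<open>Q\<close> is fixed to that of this quotient.\<close>

lemma burnside_groups_rank_two:
  assumes d: "0 < d" and e: "0 < e" "e dvd d" "e dvd d choose 2"
    and relations: "\<And>(Q :: (nat \<times> bool) list set monoid) x y. group Q \<Longrightarrow> x \<in> carrier Q \<Longrightarrow> y \<in> carrier Q \<Longrightarrow>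
      x [^]\<^bsub>Q\<^esub> d = \<one>\<^bsub>Q\<^esub> \<Longrightarrow> y [^]\<^bsub>Q\<^esub> d = \<one>\<^bsub>Q\<^esub> \<Longrightarrow> (x \<otimes>\<^bsub>Q\<^esub> y) [^]\<^bsub>Q\<^esub> d = \<one>\<^bsub>Q\<^esub> \<Longrightarrow>
      (x \<otimes>\<^bsub>Q\<^esub> inv\<^bsub>Q\<^esub> y) [^]\<^bsub>Q\<^esub> d = \<one>\<^bsub>Q\<^esub> \<Longrightarrow>
      (\<exists>z \<in> carrier Q. y \<otimes>\<^bsub>Q\<^esub> x = x \<otimes>\<^bsub>Q\<^esub> y \<otimes>\<^bsub>Q\<^esub> z \<and> z \<otimes>\<^bsub>Q\<^esub> x = x \<otimes>\<^bsub>Q\<^esub> z \<and>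
        z \<otimes>\<^bsub>Q\<^esub> y = y \<otimes>\<^bsub>Q\<^esub> z \<and> z [^]\<^bsub>Q\<^esub> e = \<one>\<^bsub>Q\<^esub>)"
  shows "primitive_burnside_group 2 d \<cong> free_burnside_group 2 d"
    and "order (free_burnside_group 2 d) = d * d * e"
proof -
  let ?H = "heisenberg d e"
  define F where "F = free_group {1::nat, 2}"
  define x y where "x = [(1::nat, True)]" and "y = [(2::nat, True)]"
  interpret F: group F unfolding F_def by (rule group_free_group)
  interpret H: group ?H by (rule group_heisenberg) (use d e in auto)
  have xy: "x \<in> carrier F" "y \<in> carrier F" by (simp_all add: x_def y_def F_def letter_closed)
  have H_carr: "(1 mod d, 0, 0) \<in> carrier ?H" "(0, 1 mod d, 0) \<in> carrier ?H"
    using d e by (simp_all add: heisenberg_def)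
  define g where "g i = (if i = 1 then (1 mod d, 0, 0) else (0, 1 mod d, 0 :: nat))" for i :: nat
  have "g i \<in> carrier ?H" for i using H_carr by (simp add: g_def)
  then obtain h where h: "h \<in> hom F ?H" and "\<forall>i\<in>{1, 2}. h [(i, True)] = g i"
    using free_group_hom_extend[OF H.is_group, of "{1, 2}" g] unfolding F_def by blast
  then have hx: "h x = (1 mod d, 0, 0)" and hy: "h y = (0, 1 mod d, 0)"
    by (auto simp: x_def y_def g_def)
  interpret h: group_hom F ?H h by unfold_locales (rule h)
  let ?K = "kernel F ?H h"
  define PR FR where "PR = {w [^]\<^bsub>F\<^esub> d |w. primitive F w}" and "FR = {w [^]\<^bsub>F\<^esub> d |w. w \<in> carrier F}"
  have "primitive F w \<Longrightarrow> w \<in> carrier F" for w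
    by (auto simp: primitive_def is_basis_def)
  then have sub: "PR \<subseteq> FR" "FR \<subseteq> carrier F" by (auto simp: PR_def FR_def)
  have exponent: "p [^]\<^bsub>?H\<^esub> d = \<one>\<^bsub>?H\<^esub>" for p
  proof -
    obtain a b c where p: "p = (a, b, c)" by (metis prod_cases3)
    have "e dvd d * c + (d choose 2) * (a * b)" using e by simp
    then show ?thesis
      unfolding p heisenberg_pow[OF d e(1,2)] by (simp add: heisenberg_def)
  qed
  have FR_K: "FR \<subseteq> ?K"
    by (auto simp: FR_def kernel_def h.hom_nat_pow exponent)
  have FK: "normal_closure F FR \<subseteq> ?K"
    using h.group_hom_axioms FR_K by (rule normal_closure_subset_kernel)
  have PF: "normal_closure F PR \<subseteq> normal_closure F FR"
    using sub unfolding normal_closure_def by blast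
  let ?N = "normal_closure F PR"
  have N: "?N \<lhd> F" using sub by (intro F.normal_normal_closure) auto
  have PR_N: "PR \<subseteq> ?N" by (auto simp: normal_closure_def)
  interpret N: normal ?N F by (rule N)
  interpret Q: group "F Mod ?N" by (rule N.factorgroup_is_group)
  interpret q: group_hom F "F Mod ?N" "\<lambda>w. ?N #>\<^bsub>F\<^esub> w"
    by unfold_locales (rule N.r_coset_hom_Mod)
  let ?q = "\<lambda>w. ?N #>\<^bsub>F\<^esub> w"
  have q_eq_one: "?q w = \<one>\<^bsub>F Mod ?N\<^esub> \<longleftrightarrow> w \<in> ?N" if "w \<in> carrier F" for w
    using that F.coset_join1[OF _ that N.subgroup_axioms] F.coset_join2[OF that N.subgroup_axioms]
    by (auto simp: FactGroup_def)
  have q_pow: "?q w [^]\<^bsub>F Mod ?N\<^esub> d = \<one>\<^bsub>F Mod ?N\<^esub>" if w: "primitive F w" for w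
  proof -
    have w_carr: "w \<in> carrier F" and "w [^]\<^bsub>F\<^esub> d \<in> ?N"
      using w PR_N by (auto simp: PR_def primitive_def is_basis_def)
    then have "?q (w [^]\<^bsub>F\<^esub> d) = \<one>\<^bsub>F Mod ?N\<^esub>" using q_eq_one by blast
    then show ?thesis using q.hom_nat_pow[OF w_carr, of d] by metis
  qed
  have one_two: "(1::nat) \<noteq> 2" by simp
  have prim: "primitive F (x \<otimes>\<^bsub>F\<^esub> y [^]\<^bsub>F\<^esub> k)" "primitive F y" for k :: int
    using primitive_transvection[OF one_two] by (simp_all add: F_def x_def y_def)
  have "primitive F x" "primitive F (x \<otimes>\<^bsub>F\<^esub> y)" "primitive F (x \<otimes>\<^bsub>F\<^esub> inv\<^bsub>F\<^esub> y)"
    using prim(1)[of 0] prim(1)[of 1] prim(1)[of "-1"] xy by (simp_all add: F.int_pow_neg)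
  from this[THEN q_pow] q_pow[OF prim(2)] obtain z where
    z: "z \<in> carrier (F Mod ?N)"
      "?q y \<otimes>\<^bsub>F Mod ?N\<^esub> ?q x = ?q x \<otimes>\<^bsub>F Mod ?N\<^esub> ?q y \<otimes>\<^bsub>F Mod ?N\<^esub> z"
      "z \<otimes>\<^bsub>F Mod ?N\<^esub> ?q x = ?q x \<otimes>\<^bsub>F Mod ?N\<^esub> z" "z \<otimes>\<^bsub>F Mod ?N\<^esub> ?q y = ?q y \<otimes>\<^bsub>F Mod ?N\<^esub> z"
      "z [^]\<^bsub>F Mod ?N\<^esub> e = \<one>\<^bsub>F Mod ?N\<^esub>"
    and powers: "?q x [^]\<^bsub>F Mod ?N\<^esub> d = \<one>\<^bsub>F Mod ?N\<^esub>" "?q y [^]\<^bsub>F Mod ?N\<^esub> d = \<one>\<^bsub>F Mod ?N\<^esub>"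
    using relations[OF Q.is_group, of "?q x" "?q y"] xy by auto
  define nf where "nf = (\<lambda>(a, b, c). ?q x [^]\<^bsub>F Mod ?N\<^esub> (a::nat) \<otimes>\<^bsub>F Mod ?N\<^esub> ?q y [^]\<^bsub>F Mod ?N\<^esub> (b::nat)
    \<otimes>\<^bsub>F Mod ?N\<^esub> z [^]\<^bsub>F Mod ?N\<^esub> (c::nat))"
  have nf: "nf \<in> hom ?H (F Mod ?N)"
    unfolding nf_def
    by (rule Q.heisenberg_hom[OF _ _ z(1-4) powers z(5)]) (use xy in simp_all)
  have nf_xy: "nf (1 mod d, 0, 0) = ?q x" "nf (0, 1 mod d, 0) = ?q y"
    using Q.heisenberg_normal_forms[OF q.hom_closed[OF xy(1)] q.hom_closed[OF xy(2)] z(1) powers]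
    unfolding nf_def by (simp_all only: prod.case)
  \<comment> \<open>The factorisation closes the chain of inclusions: whatever \<open>h\<close>
    kills is trivial in the quotient.\<close>
  have nf_h: "nf (h w) = ?q w" if w: "w \<in> carrier F" for w
  proof -
    have "(nf \<circ> h) w = ?q w"
    proof (rule hom_free_group_eqI[OF Q.is_group, of _ "{1, 2}" ?q w])
      show "nf \<circ> h \<in> hom (free_group {1, 2}) (F Mod ?N)"
        using hom_compose[OF h nf] by (simp add: F_def)
      show "?q \<in> hom (free_group {1, 2}) (F Mod ?N)"
        using q.homh by (simp add: F_def)
      fix i :: nat assume "i \<in> {1, 2}"
      then show "(nf \<circ> h) [(i, True)] = ?q [(i, True)]"
        using hx hy nf_xy by (auto simp: x_def y_def)
    qed (use w in \<open>simp add: F_def\<close>)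
    then show ?thesis by simp
  qed
  have "?K \<subseteq> ?N"
  proof
    fix w assume "w \<in> ?K"
    then have w: "w \<in> carrier F" "h w = (0, 0, 0)" by (auto simp: kernel_def heisenberg_def)
    have "nf (0, 0, 0) = \<one>\<^bsub>F Mod ?N\<^esub>"
      using Q.heisenberg_normal_forms[OF q.hom_closed[OF xy(1)] q.hom_closed[OF xy(2)] z(1) powers]
      unfolding nf_def by (simp only: prod.case)
    then show "w \<in> ?N" using nf_h[OF w(1)] w q_eq_one[OF w(1)] by metis
  qed
  with PF FK have closures: "normal_closure F PR = ?K" "normal_closure F FR = ?K" by auto
  have "{1..2} = {1, 2 :: nat}" by auto
  then have "primitive_burnside_group 2 d = F Mod normal_closure F PR"
      "free_burnside_group 2 d = F Mod normal_closure F FR"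
    by (simp_all only: primitive_burnside_group_def free_burnside_group_def presented_group_def
        PR_def FR_def F_def)
  then have groups: "primitive_burnside_group 2 d = F Mod ?K" "free_burnside_group 2 d = F Mod ?K"
    by (simp_all only: closures)
  have "h ` carrier F = carrier ?H"
  proof
    show "carrier ?H \<subseteq> h ` carrier F"
    proof
      fix p assume p: "p \<in> carrier ?H"
      obtain a b c where abc: "p = (a, b, c)" "a < d" "b < d" "c < e"
        using p by (auto simp: heisenberg_def)
      \<comment> \<open>The central generator is reached as the image of the commutator of the two
        letters.\<close>
      let ?z = "(0, 0, 1 mod e) :: nat \<times> nat \<times> nat"
      have z: "?z \<in> carrier ?H" using d e by (simp add: heisenberg_def)
      have "(1 mod d * (1 mod d)) mod e = 1 mod e"
        using e(2) by (metis mod_mod_cancel mod_mult_eq mult_1)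
      then have "h y \<otimes>\<^bsub>?H\<^esub> h x = (h x \<otimes>\<^bsub>?H\<^esub> h y) \<otimes>\<^bsub>?H\<^esub> ?z"
        by (simp add: hx hy heisenberg_def)
      then have "?z = inv\<^bsub>?H\<^esub> (h x \<otimes>\<^bsub>?H\<^esub> h y) \<otimes>\<^bsub>?H\<^esub> (h y \<otimes>\<^bsub>?H\<^esub> h x)"
        using z xy by (simp add: H.mult_inv_cancel)
      then have hz: "h (inv\<^bsub>F\<^esub> (x \<otimes>\<^bsub>F\<^esub> y) \<otimes>\<^bsub>F\<^esub> (y \<otimes>\<^bsub>F\<^esub> x)) = ?z"
        using xy by simp
      have "h (x [^]\<^bsub>F\<^esub> a \<otimes>\<^bsub>F\<^esub> y [^]\<^bsub>F\<^esub> b \<otimes>\<^bsub>F\<^esub> (inv\<^bsub>F\<^esub> (x \<otimes>\<^bsub>F\<^esub> y) \<otimes>\<^bsub>F\<^esub> (y \<otimes>\<^bsub>F\<^esub> x)) [^]\<^bsub>F\<^esub> c) =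
          (1 mod d, 0, 0) [^]\<^bsub>?H\<^esub> a \<otimes>\<^bsub>?H\<^esub> (0, 1 mod d, 0) [^]\<^bsub>?H\<^esub> b \<otimes>\<^bsub>?H\<^esub> ?z [^]\<^bsub>?H\<^esub> c"
        using xy by (simp only: h.hom_mult h.hom_nat_pow F.m_closed F.nat_pow_closed F.inv_closed hx hy flip: hz)
      also have "\<dots> = p"
        unfolding heisenberg_pow[OF d e(1,2)]
        using abc by (simp add: heisenberg_def mod_mult_right_eq)
      finally show "p \<in> h ` carrier F"
        using xy by (metis F.inv_closed F.m_closed F.nat_pow_closed image_eqI)
    qed
  qed auto
  then have "F Mod ?K \<cong> ?H" by (rule h.FactGroup_iso)
  then show "order (free_burnside_group 2 d) = d * d * e"
    unfolding groups using iso_same_card order_heisenberg by (metis order_def)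
  show "primitive_burnside_group 2 d \<cong> free_burnside_group 2 d"
    unfolding groups by (rule iso_refl)
qed

text \<open>Involutions whose product is an involution commute, so the central part is trivial and
  \<open>e = 1\<close>.\<close>

theorem burnside_groups_rank_two_exponent_two:
  "primitive_burnside_group 2 2 \<cong> free_burnside_group 2 2" "order (free_burnside_group 2 2) = 4"
proof -
  have rel: "\<exists>z \<in> carrier Q. y \<otimes>\<^bsub>Q\<^esub> x = x \<otimes>\<^bsub>Q\<^esub> y \<otimes>\<^bsub>Q\<^esub> z \<and> z \<otimes>\<^bsub>Q\<^esub> x = x \<otimes>\<^bsub>Q\<^esub> z \<and>
      z \<otimes>\<^bsub>Q\<^esub> y = y \<otimes>\<^bsub>Q\<^esub> z \<and> z [^]\<^bsub>Q\<^esub> (1::nat) = \<one>\<^bsub>Q\<^esub>"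
    if "group Q" and c: "x \<in> carrier Q" "y \<in> carrier Q" and "x [^]\<^bsub>Q\<^esub> (2::nat) = \<one>\<^bsub>Q\<^esub>"
      "y [^]\<^bsub>Q\<^esub> (2::nat) = \<one>\<^bsub>Q\<^esub>" "(x \<otimes>\<^bsub>Q\<^esub> y) [^]\<^bsub>Q\<^esub> (2::nat) = \<one>\<^bsub>Q\<^esub>" for Q :: "(nat \<times> bool) list set monoid" and x y
  proof -
    interpret group Q by fact
    have pow2: "u [^]\<^bsub>Q\<^esub> (2::nat) = u \<otimes>\<^bsub>Q\<^esub> u" if "u \<in> carrier Q" for u
      using that by (simp add: numeral_2_eq_2)
    have inv_self: "inv\<^bsub>Q\<^esub> u = u" if "u \<in> carrier Q" "u [^]\<^bsub>Q\<^esub> (2::nat) = \<one>\<^bsub>Q\<^esub>" for u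
      using that by (simp add: pow2 inv_equality)
    have "inv\<^bsub>Q\<^esub> (x \<otimes>\<^bsub>Q\<^esub> y) = inv\<^bsub>Q\<^esub> y \<otimes>\<^bsub>Q\<^esub> inv\<^bsub>Q\<^esub> x" using c by (rule inv_mult_group)
    then have "x \<otimes>\<^bsub>Q\<^esub> y = y \<otimes>\<^bsub>Q\<^esub> x" using that inv_self by simp
    then show ?thesis using c by (intro bexI[of _ "\<one>\<^bsub>Q\<^esub>"]) simp_all
  qed
  show "primitive_burnside_group 2 2 \<cong> free_burnside_group 2 2"
    by (rule burnside_groups_rank_two[where d = 2 and e = 1]) (use rel in auto)
  show "order (free_burnside_group 2 2) = 4"
    by (subst burnside_groups_rank_two(2)[where d = 2 and e = 1]) (use rel in auto)
qed

theorem burnside_groups_rank_two_exponent_three: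
  "primitive_burnside_group 2 3 \<cong> free_burnside_group 2 3" "order (free_burnside_group 2 3) = 27"
proof -
  have rel: "\<exists>z \<in> carrier Q. y \<otimes>\<^bsub>Q\<^esub> x = x \<otimes>\<^bsub>Q\<^esub> y \<otimes>\<^bsub>Q\<^esub> z \<and> z \<otimes>\<^bsub>Q\<^esub> x = x \<otimes>\<^bsub>Q\<^esub> z \<and>
      z \<otimes>\<^bsub>Q\<^esub> y = y \<otimes>\<^bsub>Q\<^esub> z \<and> z [^]\<^bsub>Q\<^esub> (3::nat) = \<one>\<^bsub>Q\<^esub>"
    if "group Q" and c: "x \<in> carrier Q" "y \<in> carrier Q" and cubes: "x [^]\<^bsub>Q\<^esub> (3::nat) = \<one>\<^bsub>Q\<^esub>"
      "y [^]\<^bsub>Q\<^esub> (3::nat) = \<one>\<^bsub>Q\<^esub>" "(x \<otimes>\<^bsub>Q\<^esub> y) [^]\<^bsub>Q\<^esub> (3::nat) = \<one>\<^bsub>Q\<^esub>"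
      "(x \<otimes>\<^bsub>Q\<^esub> inv\<^bsub>Q\<^esub> y) [^]\<^bsub>Q\<^esub> (3::nat) = \<one>\<^bsub>Q\<^esub>" for Q :: "(nat \<times> bool) list set monoid" and x y
  proof -
    interpret group Q by fact
    show ?thesis
      using heisenberg_relations_of_cubes[OF c cubes] c
      by (intro bexI[of _ "inv\<^bsub>Q\<^esub> (x \<otimes>\<^bsub>Q\<^esub> y) \<otimes>\<^bsub>Q\<^esub> (y \<otimes>\<^bsub>Q\<^esub> x)"]) (simp_all add: mult_inv_cancel)
  qed
  \<comment> \<open>Divisibility of \<open>d choose 2\<close> is what allows \<open>e = d\<close>
    here; for \<open>d = 2\<close> it fails.\<close>
  have "3 choose 2 = (3 :: nat)" by (simp add: numeral_eq_Suc)
  then have "(3::nat) dvd 3 choose 2" by simp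
  show "primitive_burnside_group 2 3 \<cong> free_burnside_group 2 3"
    by (rule burnside_groups_rank_two[where d = 3 and e = 3]) (use rel \<open>3 dvd 3 choose 2\<close> in auto)
  show "order (free_burnside_group 2 3) = 27"
    by (subst burnside_groups_rank_two(2)[where d = 3 and e = 3]) (use rel \<open>3 dvd 3 choose 2\<close> in auto)
qed

section \<open>Infinite primitive Burnside groups\<close>

text \<open>Self-maps instead of matrices, so that linear and antilinear maps compose
  uniformly.\<close>

definition function_monoid :: "('x \<Rightarrow> 'x) monoid" where
  "function_monoid = \<lparr>carrier = UNIV, mult = (\<circ>), one = id\<rparr>"

lemma monoid_function_monoid: "monoid function_monoid"
  by unfold_locales (auto simp: function_monoid_def comp_assoc)

text \<open>A multiplicative map into a monoid may send the unit to another idempotent, hence the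
  assumption \<open>one\<close>.\<close>

lemma normal_kernel_function_monoid:
  assumes "group G" and h: "h \<in> hom G function_monoid" and one: "h \<one>\<^bsub>G\<^esub> = id"
  shows "{w \<in> carrier G. h w = id} \<lhd> G"
proof -
  interpret group G by fact
  have mult: "h (u \<otimes>\<^bsub>G\<^esub> v) = h u \<circ> h v" if "u \<in> carrier G" "v \<in> carrier G" for u v
    using h that by (simp add: hom_def function_monoid_def)
  have inv: "h (inv\<^bsub>G\<^esub> u) = id" if "u \<in> carrier G" "h u = id" for u
    using mult[of "inv\<^bsub>G\<^esub> u" u] that one by simp
  have "subgroup {w \<in> carrier G. h w = id} G"
    by (rule subgroupI) (use one in \<open>auto simp: mult inv intro: exI[of _ "\<one>\<^bsub>G\<^esub>"]\<close>)
  moreover have "h (u \<otimes>\<^bsub>G\<^esub> w \<otimes>\<^bsub>G\<^esub> inv\<^bsub>G\<^esub> u) = id" if "u \<in> carrier G" "w \<in> carrier G" "h w = id" for u w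
    using that mult[of u "inv\<^bsub>G\<^esub> u"] one by (simp add: mult)
  ultimately show ?thesis by (auto simp: normal_inv_iff)
qed

text \<open>If \<open>\<rho>\<close> sends \<open>x\<^sub>1, x\<^sub>2\<close> to \<open>A, B\<close>, then the surjections \<open>t, t', t''\<close> intertwine
  \<open>\<rho>\<close> with its composites with Nielsen automorphisms. As these generate the automorphisms up to
  inner ones, every primitive word acts like \<open>A\<close> up to conjugacy.\<close>

theorem infinite_primitive_burnside_groupI:
  fixes A A' B B' t t' t'' :: "'x \<Rightarrow> 'x"
  assumes A: "A \<circ> A' = id" "A' \<circ> A = id" and B: "B \<circ> B' = id" "B' \<circ> B = id"
    and power: "A ^^ d = id"
    and t: "surj t" "A' \<circ> t = t \<circ> A" "B \<circ> t = t \<circ> B"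
    and t': "surj t'" "B \<circ> t' = t' \<circ> A" "A \<circ> t' = t' \<circ> B"
    and t'': "surj t''" "A \<circ> t'' = t'' \<circ> A" "(A \<circ> B) \<circ> t'' = t'' \<circ> B"
    and infinite_order: "\<And>n. n > 0 \<Longrightarrow> (B \<circ> A \<circ> B' \<circ> A) ^^ n \<noteq> id"
  shows "infinite (carrier (primitive_burnside_group 2 d))"
proof
  define F where "F = free_group {1::nat, 2}"
  define f where "f a = (if fst a = 1 then if snd a then A else A' else if snd a then B else B')"
    for a :: "nat \<times> bool"
  define \<rho> where "\<rho> = word_hom function_monoid f"
  interpret F: group F unfolding F_def by (rule group_free_group)
  have \<rho>: "\<rho> \<in> hom F function_monoid"
    unfolding F_def \<rho>_def
    by (rule word_hom_hom[OF monoid_function_monoid])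
      (use A B in \<open>auto simp: f_def inv_letter_def function_monoid_def\<close>)
  have mult: "\<rho> (u \<otimes>\<^bsub>F\<^esub> v) = \<rho> u \<circ> \<rho> v" if "u \<in> carrier F" "v \<in> carrier F" for u v
    using \<rho> that by (simp add: hom_def function_monoid_def)
  have one: "\<rho> \<one>\<^bsub>F\<^esub> = id"
    by (simp add: F_def one_free_group \<rho>_def function_monoid_def)
  have inv: "\<rho> (inv\<^bsub>F\<^esub> u) \<circ> \<rho> u = id" "\<rho> u \<circ> \<rho> (inv\<^bsub>F\<^esub> u) = id" if "u \<in> carrier F" for u
    using that mult[of "inv\<^bsub>F\<^esub> u" u] mult[of u "inv\<^bsub>F\<^esub> u"] one by simp_all
  have pow: "\<rho> (u [^]\<^bsub>F\<^esub> n) = \<rho> u ^^ n" if "u \<in> carrier F" for u and n :: nat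
    using that by (induction n) (simp_all add: one mult funpow_Suc_right del: funpow.simps(2))
  \<comment> \<open>The pair acts like \<open>(A, B)\<close> up to an intertwiner. Surjectivity lets
    \<open>g\<close> be cancelled on the right once the powers are compared.\<close>
  define P where "P p q \<longleftrightarrow> (\<exists>g. surj g \<and> \<rho> p \<circ> g = g \<circ> A \<and> \<rho> q \<circ> g = g \<circ> B)" for p q
  have letters: "\<rho> [(1, True)] = A" "\<rho> [(2, True)] = B"
    by (simp_all add: \<rho>_def f_def function_monoid_def)
  have one_neq_two: "(1::nat) \<noteq> 2" by simp
  have P: "P u v" if "u \<in> carrier F" "v \<in> carrier F" "generate F {u, v} = carrier F" for u v
    using that one_neq_two unfolding F_def
  proof (induction rule: nielsen_pair_induct)
    case base
    show ?case unfolding P_def letters by (rule exI[of _ id]) simp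
  next
    case (inv p q)
    then obtain g where g: "surj g" "\<rho> p \<circ> g = g \<circ> A" "\<rho> q \<circ> g = g \<circ> B" by (auto simp: P_def)
    have p: "p \<in> carrier F" using inv by (simp add: F_def)
    have "\<rho> (inv\<^bsub>F\<^esub> p) \<circ> g = \<rho> (inv\<^bsub>F\<^esub> p) \<circ> (g \<circ> A) \<circ> A'"
      using A(1) by (simp add: comp_assoc)
    also have "\<dots> = g \<circ> A'"
      using \<open>\<And>u. u \<in> carrier F \<Longrightarrow> \<rho> (inv\<^bsub>F\<^esub> u) \<circ> \<rho> u = id\<close>[OF p]
      by (simp flip: g(2) comp_assoc)
    finally have "\<rho> (inv\<^bsub>F\<^esub> p) \<circ> (g \<circ> t) = g \<circ> t \<circ> A" by (metis comp_assoc t(2))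
    moreover have "\<rho> q \<circ> (g \<circ> t) = g \<circ> t \<circ> B" by (metis comp_assoc t(3) g(3))
    ultimately show ?case
      using comp_surj[OF t(1) g(1)] unfolding P_def F_def by blast
  next
    case (swap p q)
    then obtain g where g: "surj g" "\<rho> p \<circ> g = g \<circ> A" "\<rho> q \<circ> g = g \<circ> B" by (auto simp: P_def)
    have "\<rho> q \<circ> (g \<circ> t') = g \<circ> t' \<circ> A" "\<rho> p \<circ> (g \<circ> t') = g \<circ> t' \<circ> B"
      by (metis comp_assoc t'(2) g(3)) (metis comp_assoc t'(3) g(2))
    then show ?case using comp_surj[OF t'(1) g(1)] unfolding P_def by blast
  next
    case (mult p q)
    then obtain g where g: "surj g" "\<rho> p \<circ> g = g \<circ> A" "\<rho> q \<circ> g = g \<circ> B" by (auto simp: P_def)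
    have "\<rho> p \<circ> (g \<circ> t'') = g \<circ> t'' \<circ> A" by (metis comp_assoc t''(2) g(2))
    moreover have "(\<rho> p \<circ> \<rho> q) \<circ> (g \<circ> t'') = g \<circ> t'' \<circ> B"
      by (metis comp_assoc t''(3) g(2,3))
    moreover have "\<rho> (p \<otimes>\<^bsub>F\<^esub> q) = \<rho> p \<circ> \<rho> q"
      using \<open>\<And>u v. u \<in> carrier F \<Longrightarrow> v \<in> carrier F \<Longrightarrow> \<rho> (u \<otimes>\<^bsub>F\<^esub> v) = \<rho> u \<circ> \<rho> v\<close> mult
      by (simp add: F_def)
    ultimately show ?case
      using comp_surj[OF t''(1) g(1)] unfolding P_def F_def by metis
  next
    case (conj p q c)
    then obtain g where g: "surj g" "\<rho> p \<circ> g = g \<circ> A" "\<rho> q \<circ> g = g \<circ> B" by (auto simp: P_def)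
    have carr: "p \<in> carrier F" "q \<in> carrier F" "c \<in> carrier F" using conj by (simp_all add: F_def)
    have "surj (\<rho> c)" by (rule surjI[of _ "\<rho> (inv\<^bsub>F\<^esub> c)"]) (use inv(2)[OF carr(3)] in \<open>simp add: fun_eq_iff\<close>)
    have "\<rho> (c \<otimes>\<^bsub>F\<^esub> x \<otimes>\<^bsub>F\<^esub> inv\<^bsub>F\<^esub> c) \<circ> (\<rho> c \<circ> g) = \<rho> c \<circ> (\<rho> x \<circ> g)" if "x \<in> carrier F" for x
    proof -
      have "\<rho> (c \<otimes>\<^bsub>F\<^esub> x \<otimes>\<^bsub>F\<^esub> inv\<^bsub>F\<^esub> c) \<circ> (\<rho> c \<circ> g) = \<rho> c \<circ> \<rho> x \<circ> (\<rho> (inv\<^bsub>F\<^esub> c) \<circ> \<rho> c) \<circ> g"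
        using that carr by (simp add: mult comp_assoc)
      then show ?thesis using inv(1)[OF carr(3)] by (simp add: comp_assoc)
    qed
    then show ?case
      using carr g comp_surj[OF g(1) \<open>surj (\<rho> c)\<close>] unfolding P_def F_def[symmetric]
      by (metis comp_assoc)
  qed
  define N where "N = normal_closure F {w [^]\<^bsub>F\<^esub> d |w. primitive F w}"
  have "{1..2} = {1, 2 :: nat}" by auto
  have Q: "primitive_burnside_group 2 d = F Mod N"
    unfolding primitive_burnside_group_def presented_group_def N_def F_def
    using \<open>{1..2} = {1, 2 :: nat}\<close> by simp
  have "\<rho> (w [^]\<^bsub>F\<^esub> d) = id" if w: "primitive F w" for w
  proof -
    obtain v where "v \<in> carrier F" "generate F {w, v} = carrier F" and w_carr: "w \<in> carrier F"
      using primitive_generating_pair[of 1 2 w] w unfolding F_def by blast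
    then obtain g where g: "surj g" "\<rho> w \<circ> g = g \<circ> A" using P[of w v] unfolding P_def by blast
    have "(\<rho> w ^^ n) \<circ> g = g \<circ> (A ^^ n)" for n
    proof (induction n)
      case (Suc n)
      have "(\<rho> w ^^ Suc n) \<circ> g = (\<rho> w ^^ n) \<circ> (\<rho> w \<circ> g)" by (simp only: funpow_Suc_right comp_assoc)
      also have "\<dots> = g \<circ> (A ^^ n) \<circ> A" by (simp only: g(2) Suc[symmetric] comp_assoc)
      also have "\<dots> = g \<circ> (A ^^ Suc n)" by (simp only: funpow_Suc_right comp_assoc)
      finally show ?case .
    qed simp
    from this[of d] have "(\<rho> w ^^ d) \<circ> g = id \<circ> g" using power by simp
    then have "\<rho> w ^^ d = id" using g(1) by (metis surj_fun_eq)
    then show ?thesis using pow[OF w_carr] by simp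
  qed
  moreover have "w [^]\<^bsub>F\<^esub> d \<in> carrier F" if "primitive F w" for w
    using primitive_generating_pair(1)[of 1 2 w] that unfolding F_def[symmetric] by simp
  ultimately have R: "{w [^]\<^bsub>F\<^esub> d |w. primitive F w} \<subseteq> {w \<in> carrier F. \<rho> w = id}"
    by blast
  have N: "N \<lhd> F"
    unfolding N_def by (rule F.normal_normal_closure) (use R in blast)
  have N_kernel: "N \<subseteq> {w \<in> carrier F. \<rho> w = id}"
    unfolding N_def normal_closure_def
    using normal_kernel_function_monoid[OF F.is_group \<rho> one] R by blast
  interpret N: normal N F by (rule N)
  interpret Q: group "F Mod N" by (rule N.factorgroup_is_group)
  \<comment> \<open>In a finite quotient the power of \<open>w\<close> by the group order would lie
    in \<open>N\<close> and so act trivially, against \<open>infinite_order\<close>.\<close>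
  define w where "w = [(2::nat, True), (1, True), (2, False), (1, True)]"
  have w: "w \<in> carrier F"
    by (simp add: w_def F_def carrier_free_group_iff reduced_def inv_letter_def)
  have \<rho>_w: "\<rho> w = B \<circ> A \<circ> B' \<circ> A"
    by (simp add: w_def \<rho>_def f_def function_monoid_def comp_assoc)
  assume "finite (carrier (primitive_burnside_group 2 d))"
  then have fin: "finite (carrier (F Mod N))" by (simp add: Q)
  then have pos: "order (F Mod N) > 0" using Q.order_gt_0_iff_finite by simp
  have "N #>\<^bsub>F\<^esub> w \<in> carrier (F Mod N)" using w by (auto simp: FactGroup_def RCOSETS_def)
  from Q.pow_order_eq_1[OF this]
  have "N #>\<^bsub>F\<^esub> (w [^]\<^bsub>F\<^esub> order (F Mod N)) = N"
    using N.FactGroup_pow[OF w] by (simp add: FactGroup_def)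
  then have "w [^]\<^bsub>F\<^esub> order (F Mod N) \<in> N"
    using F.coset_join1[OF _ _ N.subgroup_axioms] w by simp
  then show False
    using N_kernel pow[OF w] infinite_order[OF pos] \<rho>_w by auto
qed

text \<open>In the reduced Burau representation with parameter \<open>-s\<close>, the functions below are the images
  \<open>A\<close> of \<open>\<sigma>\<^sub>1 \<sigma>\<^sub>3\<^sup>-\<^sup>1\<close>, \<open>B\<close> of its conjugate by \<open>\<sigma>\<^sub>2\<close>, \<open>R\<close> of
  \<open>\<sigma>\<^sub>2 \<sigma>\<^sub>1 \<sigma>\<^sub>3\<close> and \<open>T\<close> of \<open>\<sigma>\<^sub>3\<^sup>-\<^sup>1\<close>; primes denote inverses. The antilinear
  involution \<open>J\<close> is an intertwiner that inverts \<open>A\<close> and fixes \<open>B\<close>.\<close>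

type_synonym complex3 = "complex \<times> complex \<times> complex"

text \<open>The parameter lies on the unit circle. Its inverse is a separate symbol, which keeps all
  matrix identities polynomial and within reach of the simplifier.\<close>

locale burau =
  fixes s r :: complex
  assumes sr: "s * r = 1" and cnj_s: "cnj s = r"
begin

lemma rs: "r * s = 1"
  using sr by (simp add: mult.commute)

lemma cnj_r: "cnj r = s"
  using cnj_s by (metis complex_cnj_cnj)

fun A :: "complex3 \<Rightarrow> complex3" where "A (x, y, z) = (s * x + y, y, r * z + y)"
fun A' :: "complex3 \<Rightarrow> complex3" where "A' (x, y, z) = (r * x - r * y, y, s * z - s * y)"
fun B :: "complex3 \<Rightarrow> complex3" where
  "B (x, y, z) = ((1 + s) * x + r * y - r * z, (1 - s^2) * x + r * y, x + r * y)"
fun B' :: "complex3 \<Rightarrow> complex3" where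
  "B' (x, y, z) = (r^2 * z - r^2 * y, r * y + (s - r) * z, (1 + s) * z - s * x - y)"
fun J :: "complex3 \<Rightarrow> complex3" where
  "J (x, y, z) = (r * cnj x + cnj y, - (s * cnj y), s * cnj z - s * cnj y)"
fun R :: "complex3 \<Rightarrow> complex3" where
  "R (x, y, z) = (s * x + y, s * z - s * y - s^2 * x, s * z - s * y)"
fun R' :: "complex3 \<Rightarrow> complex3" where
  "R' (x, y, z) = (r * x - r * (r * y + x - r * z), r * y + x - r * z, r * z + (r * y + x - r * z))"
fun T :: "complex3 \<Rightarrow> complex3" where "T (x, y, z) = (x, y, r * z + y)"
fun T' :: "complex3 \<Rightarrow> complex3" where "T' (x, y, z) = (x, y, s * z - s * y)"

section \<open>Relations between the Burau maps\<close>

lemma eqI3: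
  "(\<And>x y z. f (x, y, z) = g (x, y, z)) \<Longrightarrow> f = g" for f g :: "complex3 \<Rightarrow> complex3"
  by (simp add: fun_eq_iff split_paired_all)

lemma mult_cancel: "s * (r * t) = t" "r * (s * t) = t"
  by (simp_all add: sr rs flip: mult.assoc)

lemmas action_simps = sr rs mult_cancel cnj_s cnj_r algebra_simps power2_eq_square power3_eq_cube

lemma A_inverse: "A \<circ> A' = id" "A' \<circ> A = id"
  by (rule eqI3, simp add: action_simps)+

lemma B_inverse: "B \<circ> B' = id" "B' \<circ> B = id"
  by (rule eqI3, simp add: action_simps)+

lemma J_inverse: "J \<circ> J = id"
  by (rule eqI3, simp add: action_simps)

lemma R_inverse: "R \<circ> R' = id"
  by (rule eqI3, simp add: action_simps)

lemma T_inverse: "T \<circ> T' = id"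
  by (rule eqI3, simp add: action_simps)

lemma J_conj: "A' \<circ> J = J \<circ> A" "B \<circ> J = J \<circ> B"
  by (rule eqI3, simp add: action_simps)+

lemma R_conj: "B \<circ> R = R \<circ> A" "A' \<circ> R = R \<circ> B"
  by (rule eqI3, simp add: action_simps)+

lemma T_conj: "A \<circ> T = T \<circ> A" "(A \<circ> B) \<circ> T = T \<circ> B"
  by (rule eqI3, simp add: action_simps)+

text \<open>The off-diagonal entries are geometric sums, which vanish at nontrivial roots of unity
  of order dividing \<open>n\<close>.\<close>

lemma A_power:
  "(A ^^ n) (x, y, z) = (s ^ n * x + (\<Sum>i<n. s ^ i) * y, y, r ^ n * z + (\<Sum>i<n. r ^ i) * y)"
proof (induction n)
  case (Suc n)
  have "(\<Sum>i<Suc n. t ^ i) = 1 + t * (\<Sum>i<n. t ^ i)" for t :: complex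
    by (simp only: sum.lessThan_Suc_shift) (simp add: sum_distrib_left)
  with Suc show ?case by (simp add: algebra_simps)
qed simp

text \<open>The plane \<open>y = (1 - s) * x\<close> is invariant; in the coordinates
  \<open>x\<close> and \<open>z\<close> the map becomes a two-by-two matrix of determinant
  1.\<close>

lemma commutator_action:
  "(B \<circ> A \<circ> B' \<circ> A) (x, (1 - s) * x, z) =
    (let x' = (1 + s - s^3) * x + (1 + s) * (1 - r^3) * z
     in (x', (1 - s) * x', (1 - s^2) * x + (1 + r - r^3) * z))"
  unfolding Let_def by (simp add: action_simps)

end

context burau
begin

text \<open>\<open>R\<close> takes \<open>(A, B)\<close> to \<open>(B, A')\<close>, a quarter turn
  on the abelianisation; the reflection \<open>J\<close> removes the inverse.\<close>

lemma swap_conj: "surj (J \<circ> R)" "B \<circ> (J \<circ> R) = (J \<circ> R) \<circ> A" "A \<circ> (J \<circ> R) = (J \<circ> R) \<circ> B"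
proof -
  show "surj (J \<circ> R)"
    using surjI[of J J, OF pointfree_idE[OF J_inverse]] surjI[of R R', OF pointfree_idE[OF R_inverse]]
    by (intro comp_surj)
  show "B \<circ> (J \<circ> R) = (J \<circ> R) \<circ> A"
    by (metis J_conj(2) R_conj(1) comp_assoc)
  have "A \<circ> J = (A \<circ> J \<circ> A) \<circ> A'" by (simp only: comp_assoc A_inverse comp_id)
  also have "\<dots> = (A \<circ> A') \<circ> J \<circ> A'" by (simp only: comp_assoc J_conj[symmetric])
  also have "\<dots> = J \<circ> A'" by (simp only: A_inverse id_comp)
  finally show "A \<circ> (J \<circ> R) = (J \<circ> R) \<circ> B"
    by (metis R_conj(2) comp_assoc)
qed

text \<open>By Cayley-Hamilton with determinant 1, the first coordinates along the orbit of
  \<open>(0, 0, 1)\<close> satisfy \<open>X (n + 2) = k * X (n + 1) - X n\<close>. They start with 0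
  and the nonzero off-diagonal entry, and \<open>k\<close> at least 2 makes their norms strictly
  increase.\<close>

lemma funpow_neq_id:
  assumes trace: "2 + (s + r) - (s^3 + r^3) = of_real k" and k: "2 \<le> k"
    and entry: "(1 + s) * (1 - r^3) \<noteq> 0" and n: "0 < n"
  shows "(B \<circ> A \<circ> B' \<circ> A) ^^ n \<noteq> id"
proof
  let ?g = "B \<circ> A \<circ> B' \<circ> A"
  define a b c d where "a = 1 + s - s^3" and "b = (1 + s) * (1 - r^3)"
    and "c = 1 - s^2" and "d = 1 + r - r^3"
  define p where "p = rec_nat (0, 1) (\<lambda>_ (x, z). (a * x + b * z, c * x + d * z))"
  define X Z where "X n = fst (p n)" and "Z n = snd (p n)" for n
  have init: "X 0 = 0" "Z 0 = 1" by (simp_all add: X_def Z_def p_def)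
  have step: "X (Suc n) = a * X n + b * Z n" "Z (Suc n) = c * X n + d * Z n" for n
    by (simp_all add: X_def Z_def p_def case_prod_unfold)
  have iter: "(?g ^^ n) (0, 0, 1) = (X n, (1 - s) * X n, Z n)" for n
  proof (induction n)
    case (Suc n)
    have "(?g ^^ Suc n) (0, 0, 1) = ?g ((?g ^^ n) (0, 0, 1))" by simp
    then show ?case
      unfolding Suc by (simp only: commutator_action Let_def step a_def b_def c_def d_def)
  qed (simp add: init)
  have ad: "a + d = of_real k" using trace by (simp add: a_def d_def algebra_simps)
  have det: "a * d - b * c = 1"
    by (simp add: a_def b_def c_def d_def action_simps)
  have rec: "X (Suc (Suc n)) = of_real k * X (Suc n) - X n" for n
  proof -
    have "X (Suc (Suc n)) = (a + d) * X (Suc n) - (a * d - b * c) * X n"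
      by (simp add: step algebra_simps)
    then show ?thesis by (simp add: ad det)
  qed
  have mono: "norm (X n) < norm (X (Suc n))" for n
  proof (induction n)
    case 0
    then show ?case using entry by (simp add: step init b_def)
  next
    case (Suc n)
    have "norm (of_real k * X (Suc n)) - norm (X n) \<le> norm (X (Suc (Suc n)))"
      unfolding rec by (rule norm_triangle_ineq2)
    moreover have "2 * norm (X (Suc n)) \<le> norm (of_real k * X (Suc n))"
      using k by (simp add: norm_mult mult_right_mono)
    ultimately show ?case using Suc by linarith
  qed
  have "norm (X 0) < norm (X n)"
    using lift_Suc_mono_less[of "\<lambda>n. norm (X n)" 0 n] mono n by blast
  moreover assume "?g ^^ n = id"
  then have "X n = 0" using iter[of n] by (simp only: id_apply prod.inject)
  ultimately show False by simp
qed

end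

section \<open>Specialisation at a primitive root of unity\<close>

theorem infinite_primitive_burnside_group:
  assumes "4 \<le> d"
  shows "infinite (carrier (primitive_burnside_group 2 d))"
proof -
  define \<theta> where "\<theta> = 2 * pi / d"
  have \<theta>: "0 < \<theta>" "\<theta> \<le> pi / 2" using assms by (simp_all add: \<theta>_def field_simps)
  define s where "s = cis \<theta>"
  define r where "r = cnj s"
  define c where "c = 2 * cos \<theta>"
  \<comment> \<open>The bound \<open>4 \<le> d\<close> keeps the angle within the first quadrant,
    where the cosine is nonnegative.\<close>
  have c: "0 \<le> c" "c \<le> 2" using \<theta> by (simp_all add: c_def cos_ge_zero)
  have sr: "s * r = 1" by (simp add: r_def s_def cis_cnj cis_mult)
  interpret burau s r by unfold_locales (rule sr, simp add: r_def)
  have sum: "s + r = of_real c"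
    by (simp add: complex_eq_iff r_def s_def c_def)
  have "s \<noteq> 1"
  proof
    assume "s = 1"
    then have "sin \<theta> = 0" by (simp add: s_def complex_eq_iff)
    then show False using sin_gt_zero[of \<theta>] \<theta> pi_gt_zero by simp
  qed
  have "s ^ d = 1" using assms by (simp add: s_def DeMoivre \<theta>_def)
  then have "r ^ d = 1" unfolding r_def by (metis complex_cnj_one complex_cnj_power)
  have "r \<noteq> 1" using \<open>s \<noteq> 1\<close> sr by auto
  have geom: "(\<Sum>i<d. t ^ i) = 0" if "t \<noteq> 1" "t ^ d = 1" for t :: complex
    using that by (simp add: geometric_sum)
  have power: "A ^^ d = id"
    by (rule eqI3)
      (simp add: A_power geom \<open>s \<noteq> 1\<close> \<open>r \<noteq> 1\<close> \<open>s ^ d = 1\<close> \<open>r ^ d = 1\<close>)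
  have surj_J: "surj J" by (rule surjI[of J J, OF pointfree_idE[OF J_inverse]])
  have surj_T: "surj T" by (rule surjI[of T T', OF pointfree_idE[OF T_inverse]])
  have order: "(B \<circ> A \<circ> B' \<circ> A) ^^ n \<noteq> id" if "0 < n" for n
  proof (rule funpow_neq_id[OF _ _ _ that])
    \<comment> \<open>In terms of \<open>c\<close> the cubes sum to \<open>c^3 - 3 * c\<close>,
      which turns the trace into \<open>2 + c * (4 - c^2)\<close>.\<close>
    have cubes: "s^3 + r^3 = (s + r)^3 - 3 * (s + r)"
      by (simp add: action_simps)
    show "2 + (s + r) - (s^3 + r^3) = of_real (2 + c * (4 - c^2))"
      unfolding cubes sum by (simp add: algebra_simps power2_eq_square power3_eq_cube)
    have "c^2 \<le> 2^2" using c by (intro power_mono) auto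
    then show "2 \<le> 2 + c * (4 - c^2)" using c by simp
    have "1 + s \<noteq> 0"
    proof
      assume "1 + s = 0"
      then have "s = -1" by (simp add: add_eq_0_iff)
      then have "s + r = -2" by (simp add: r_def)
      then show False using sum c by (simp add: complex_eq_iff)
    qed
    \<comment> \<open>A nontrivial cube root of unity would give \<open>c = -1\<close>, the value
      belonging to exponent three.\<close>
    moreover have "1 - r^3 \<noteq> 0"
    proof
      assume "1 - r^3 = 0"
      moreover have "1 - r^3 = (1 - r) * (1 + r + r^2)"
        by (simp add: algebra_simps power2_eq_square power3_eq_cube)
      ultimately have "1 + r + r^2 = 0" using \<open>r \<noteq> 1\<close> by simp
      then have "s * (1 + r + r^2) = 0" by simp
      then have "s + r = -1" by (simp add: action_simps add_eq_0_iff)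
      then show False using sum c by (simp add: complex_eq_iff)
    qed
    ultimately show "(1 + s) * (1 - r^3) \<noteq> 0" by simp
  qed
  show ?thesis
    by (rule infinite_primitive_burnside_groupI[OF A_inverse B_inverse power surj_J J_conj
          swap_conj surj_T T_conj order])
qed

theorem corollary1p3:
  shows "(primitive_burnside_group 2 2 \<cong> free_burnside_group 2 2 \<and>
            order (free_burnside_group 2 2) = 4) \<and>
         (primitive_burnside_group 2 3 \<cong> free_burnside_group 2 3 \<and>
            order (free_burnside_group 2 3) = 27) \<and>
         (infinite (carrier (primitive_burnside_group 2 4)) \<and>
            infinite (carrier (primitive_burnside_group 2 5)))"
  using burnside_groups_rank_two_exponent_two burnside_groups_rank_two_exponent_three
    infinite_primitive_burnside_group[of 4] infinite_primitive_burnside_group[of 5] by simp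

end
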